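(* Let $T>0$. Let $\beta,\sigma:\mathbb R\times[0,\infty)\to\mathbb R$ be continuous, with $\beta$ locally Lipschitz in $x$, $\sigma$ locally H\"older(1/2) in $x$, and $|\sigma(x,t)|\le D(1+x^+)$, $|\beta(x,t)|\le D(1+|x|)$ for a constant $D$. Let $X$ solve $dX_t=\beta(X_t,t)\,dt+\sigma(X_t,t)\,dB_t$ and set $\alpha=\sigma^2/2$. Assume that $\alpha(x,t)=\gamma(t)$ for some function $\gamma$ (i.e. $\alpha$ does not depend on $x$), and that $\beta$ is convex in $x$ for each fixed $t$. Then the $T$-bond price $u(x,t)=E_{x,t}[\exp\{-\int_t^TX_s\,ds\}]$ is log-concave in $x$ at every fixed time $t\in[0,T]$.
   Context: $E_{x,t}$ denotes expectation conditional on $X_t=x$. Log-concave means $x\mapsto\ln u(x,t)$ is concave. *)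

theory Defs
  imports "HOL-Probability.Probability"
begin

definition is_filtration :: "'a measure \<Rightarrow> (real \<Rightarrow> 'a measure) \<Rightarrow> bool" where
  "is_filtration M F \<longleftrightarrow>
     (\<forall>s\<ge>0. subalgebra M (F s)) \<and>
     (\<forall>s s'. 0 \<le> s \<longrightarrow> s \<le> s' \<longrightarrow> sets (F s) \<subseteq> sets (F s'))"

definition brownian_motion :: "'a measure \<Rightarrow> (real \<Rightarrow> 'a measure) \<Rightarrow> (real \<Rightarrow> 'a \<Rightarrow> real) \<Rightarrow> bool" where
  "brownian_motion M F B \<longleftrightarrow>
     (\<forall>\<omega>\<in>space M. B 0 \<omega> = 0 \<and> continuous_on {0..} (\<lambda>s. B s \<omega>)) \<and>
     (\<forall>s\<ge>0. B s \<in> borel_measurable (F s)) \<and>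
     (\<forall>s s'. 0 \<le> s \<longrightarrow> s < s' \<longrightarrow>
        distributed M lborel (\<lambda>\<omega>. B s' \<omega> - B s \<omega>) (normal_density 0 (sqrt (s' - s))) \<and>
        (\<forall>A\<in>sets (F s). \<forall>C\<in>sets borel.
           measure M (A \<inter> {\<omega>\<in>space M. B s' \<omega> - B s \<omega> \<in> C}) =
           measure M A * measure M {\<omega>\<in>space M. B s' \<omega> - B s \<omega> \<in> C}))"

definition ito_riemann_sum ::
    "(real \<Rightarrow> 'a \<Rightarrow> real) \<Rightarrow> (real \<Rightarrow> 'a \<Rightarrow> real) \<Rightarrow> real \<Rightarrow> real \<Rightarrow> nat \<Rightarrow> 'a \<Rightarrow> real" where
  "ito_riemann_sum H B t s n \<omega> =
     (\<Sum>k<n. H (t + real k * (s - t) / real n) \<omega> *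
        (B (t + real (Suc k) * (s - t) / real n) \<omega> - B (t + real k * (s - t) / real n) \<omega>))"

text \<open>I is (a version of) the Ito integral of the continuous adapted integrand H over [t,s]:
  the left-point Riemann sums converge to I in probability.\<close>
definition is_ito_integral ::
    "'a measure \<Rightarrow> (real \<Rightarrow> 'a \<Rightarrow> real) \<Rightarrow> (real \<Rightarrow> 'a \<Rightarrow> real) \<Rightarrow> real \<Rightarrow> real \<Rightarrow> ('a \<Rightarrow> real) \<Rightarrow> bool" where
  "is_ito_integral M H B t s I \<longleftrightarrow>
     (\<forall>\<epsilon>>0. (\<lambda>n. measure M {\<omega>\<in>space M. \<bar>ito_riemann_sum H B t s n \<omega> - I \<omega>\<bar> > \<epsilon>})
              \<longlonglongrightarrow> 0)"

definition sde_solution ::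
    "'a measure \<Rightarrow> (real \<Rightarrow> 'a measure) \<Rightarrow> (real \<Rightarrow> 'a \<Rightarrow> real) \<Rightarrow>
     (real \<Rightarrow> real \<Rightarrow> real) \<Rightarrow> (real \<Rightarrow> real \<Rightarrow> real) \<Rightarrow>
     real \<Rightarrow> real \<Rightarrow> real \<Rightarrow> (real \<Rightarrow> 'a \<Rightarrow> real) \<Rightarrow> bool" where
  "sde_solution M F B \<beta> \<sigma> t T x X \<longleftrightarrow>
     prob_space M \<and> is_filtration M F \<and> brownian_motion M F B \<and>
     (\<forall>s\<in>{t..T}. X s \<in> borel_measurable (F s)) \<and>
     (\<forall>\<omega>\<in>space M. X t \<omega> = x \<and> continuous_on {t..T} (\<lambda>s. X s \<omega>)) \<and>
     (\<forall>s\<in>{t..T}. is_ito_integral M (\<lambda>r \<omega>. \<sigma> (X r \<omega>) r) B t s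
        (\<lambda>\<omega>. X s \<omega> - x - integral {t..s} (\<lambda>r. \<beta> (X r \<omega>) r)))"

definition bond_price :: "'a measure \<Rightarrow> (real \<Rightarrow> 'a \<Rightarrow> real) \<Rightarrow> real \<Rightarrow> real \<Rightarrow> real" where
  "bond_price M X t T = (\<integral>\<omega>. exp (- integral {t..T} (\<lambda>s. X s \<omega>)) \<partial>M)"

end

theory Submission
  imports Defs
begin

text \<open>Since \<^term>\<open>\<sigma>\<close> is continuous and its square does not depend on \<^term>\<open>x\<close>, neither does
  \<^term>\<open>\<sigma>\<close>: the noise is additive. Being convex with linear growth, the drift is globally Lipschitz
  in \<^term>\<open>x\<close>, so one step \<^term>\<open>x + h * \<beta> x r\<close> of the Euler scheme is nondecreasing and convex for
  small \<^term>\<open>h\<close>. The bond price of the Euler scheme is computed by a backward recursion whose step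
  averages over a Gaussian shift, composes with this map and multiplies by \<^term>\<open>exp (- h * x)\<close>.
  By the Prekopa-Leindler inequality the average of a nonincreasing log-concave function is again
  log-concave and nonincreasing; so is its composition with a nondecreasing convex map.
  Finally the Euler prices, driven by the Brownian motion that drives \<^term>\<open>X\<close>, converge to the
  bond price: the noise error is controlled by exponential moments of Brownian sums, the drift error
  by a discrete Gronwall inequality, and the exponentials are bounded in \<open>L\<^sup>2\<close>. Concavity
  passes to the pointwise limit.\<close>

text \<open>Solutions for different starting points may live on different probability spaces, so
  they cannot be compared path by path. The Euler price mediates between them: it depends only on
  the coefficients and on x, its log-concavity in x is a statement about Gaussian integrals, and its
  convergence is shown for each x on the space belonging to that x. Monotonicity has to travel with
  log-concavity: composing with a convex map keeps \<open>ln (v x)\<close> concave when v is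
  antitone, and the Euler map must be nondecreasing so that the composition is antitone again. The
  Ito integral is given as a limit in probability of Riemann sums, which carries no moment
  information. Moments are computed for finite weighted sums of increments, uniformly under
  refinement of the mesh, and reach the integral through Fatou's lemma. Additive noise enters twice:
  one Gaussian shift acts at all the points that Prekopa-Leindler compares, and the noise error
  stays outside the Gronwall recursion.\<close>

section \<open>The Prekopa-Leindler inequality\<close>

text \<open>Brunn-Minkowski on the line, for an interval K. The segment between two combined points
  lies in K, so the spreads of I and J add up with weights l and 1 - l. Letting the points approach
  the infima and suprema measures I and J by their enclosing intervals, and upper bounds for both
  suffice.\<close>

lemma emeasure_convex_combination_le:
  fixes I J K :: "real set" and l :: real
  assumes l: "0 < l" "l < 1"
    and IJ: "I \<noteq> {}" "J \<noteq> {}"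
    and K: "convex K" "K \<in> sets borel" "emeasure lborel K < \<infinity>"
    and sub: "\<And>a b. a \<in> I \<Longrightarrow> b \<in> J \<Longrightarrow> l * a + (1 - l) * b \<in> K"
  shows "ennreal l * emeasure lborel I + ennreal (1 - l) * emeasure lborel J \<le> emeasure lborel K"
proof -
  define \<kappa> where "\<kappa> = measure lborel K"
  have Keq: "emeasure lborel K = ennreal \<kappa>" "0 \<le> \<kappa>"
    using K(3) unfolding \<kappa>_def by (auto simp: emeasure_eq_ennreal_measure)
  have key: "l * (a2 - a1) + (1 - l) * (b2 - b1) \<le> \<kappa>"
    if "a1 \<in> I" "a2 \<in> I" "b1 \<in> J" "b2 \<in> J" for a1 a2 b1 b2
  proof (cases "l * a1 + (1 - l) * b1 \<le> l * a2 + (1 - l) * b2")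
    case True
    have "closed_segment (l * a1 + (1 - l) * b1) (l * a2 + (1 - l) * b2) \<subseteq> K"
      using K(1) sub that by (intro closed_segment_subset) auto
    then have "{l * a1 + (1 - l) * b1..l * a2 + (1 - l) * b2} \<subseteq> K"
      using True by (simp add: closed_segment_eq_real_ivl)
    then have "emeasure lborel {l * a1 + (1 - l) * b1..l * a2 + (1 - l) * b2} \<le> ennreal \<kappa>"
      using K(2) Keq(1) by (metis emeasure_mono sets_lborel)
    then show ?thesis using True Keq(2) by (simp add: algebra_simps)
  next
    case False
    then show ?thesis using Keq(2) by (simp add: algebra_simps)
  qed
  obtain a0 b0 where a0: "a0 \<in> I" and b0: "b0 \<in> J" using IJ by blast
  \<comment> \<open>With both points of J equal to b0, \<open>key\<close> bounds l times the
    distance from a0 by \<kappa>. Finite measure of K thus makes I bounded, and likewise J.\<close>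
  have "a \<in> {a0 - \<kappa> / l..a0 + \<kappa> / l}" if "a \<in> I" for a
    using key[OF a0 that b0 b0] key[OF that a0 b0 b0] l by (simp add: field_simps)
  then have bI: "bdd_above I" "bdd_below I" by (meson atLeastAtMost_iff bdd_above.I bdd_below.I)+
  have "b \<in> {b0 - \<kappa> / (1 - l)..b0 + \<kappa> / (1 - l)}" if "b \<in> J" for b
    using key[OF a0 a0 b0 that] key[OF a0 a0 that b0] l by (simp add: field_simps)
  then have bJ: "bdd_above J" "bdd_below J" by (meson atLeastAtMost_iff bdd_above.I bdd_below.I)+
  have infsup: "Inf I \<le> Sup I" "Inf J \<le> Sup J"
    using a0 b0 bI bJ by (meson cInf_lower cSup_upper order_trans)+
  have "l * (Sup I - Inf I) + (1 - l) * (Sup J - Inf J) \<le> \<kappa>"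
  proof (rule field_le_epsilon)
    fix e :: real assume e: "0 < e"
    have "\<exists>a2\<in>I. Sup I - e / 2 < a2" "\<exists>b2\<in>J. Sup J - e / 2 < b2"
      using bI bJ IJ e by (auto intro!: less_cSupD)
    moreover have "\<exists>a1\<in>I. a1 < Inf I + e / 2" "\<exists>b1\<in>J. b1 < Inf J + e / 2"
      using IJ e by (auto intro!: cInf_lessD)
    ultimately obtain a1 a2 b1 b2 where ab: "a1 \<in> I" "a2 \<in> I" "b1 \<in> J" "b2 \<in> J"
      "Sup I - Inf I \<le> a2 - a1 + e" "Sup J - Inf J \<le> b2 - b1 + e" by force
    have "l * (Sup I - Inf I) + (1 - l) * (Sup J - Inf J)
        \<le> l * (a2 - a1 + e) + (1 - l) * (b2 - b1 + e)"
      using ab l by (intro add_mono mult_left_mono) auto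
    also have "\<dots> \<le> \<kappa> + e" using key[OF ab(1-4)] by (simp add: algebra_simps)
    finally show "l * (Sup I - Inf I) + (1 - l) * (Sup J - Inf J) \<le> \<kappa> + e" .
  qed
  moreover have "emeasure lborel I \<le> emeasure lborel {Inf I..Sup I}"
    using bI by (intro emeasure_mono) (auto intro: cInf_lower cSup_upper)
  moreover have "emeasure lborel J \<le> emeasure lborel {Inf J..Sup J}"
    using bJ by (intro emeasure_mono) (auto intro: cInf_lower cSup_upper)
  ultimately have "ennreal l * emeasure lborel I + ennreal (1 - l) * emeasure lborel J
     \<le> ennreal l * ennreal (Sup I - Inf I) + ennreal (1 - l) * ennreal (Sup J - Inf J)"
    using infsup by (intro add_mono mult_left_mono) auto
  also have "\<dots> = ennreal (l * (Sup I - Inf I) + (1 - l) * (Sup J - Inf J))"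
    using infsup l by (simp add: ennreal_mult' ennreal_plus)
  also have "\<dots> \<le> ennreal \<kappa>"
    by (rule ennreal_leI) fact
  finally show ?thesis by (simp add: Keq)
qed

text \<open>Heights are cut at 1 because the Brunn-Minkowski step needs nonempty superlevel sets.
  Functions scaled to supremum 1 lose nothing by the cut, and for the function on the larger side it
  only lowers the integral.\<close>

lemma nn_integral_min_layer_cake:
  fixes f :: "real \<Rightarrow> real"
  assumes [measurable]: "f \<in> borel_measurable borel"
  shows "(\<integral>\<^sup>+x. ennreal (min 1 (f x)) \<partial>lborel)
    = (\<integral>\<^sup>+s\<in>{0<..<1}. emeasure lborel {x. s < f x} \<partial>lborel)"
proof -
  have "(\<integral>\<^sup>+x. ennreal (min 1 (f x)) \<partial>lborel)
      = (\<integral>\<^sup>+x. (\<integral>\<^sup>+s. indicator {0<..<1} s * indicator {x. s < f x} x \<partial>lborel) \<partial>lborel)"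
  proof (rule nn_integral_cong)
    fix x
    have "(\<integral>\<^sup>+s. indicator {0<..<1} s * indicator {x. s < f x} x \<partial>lborel)
        = (\<integral>\<^sup>+s. indicator {0<..<min 1 (f x)} s \<partial>lborel)"
      by (rule nn_integral_cong) (auto simp: indicator_def)
    then show "ennreal (min 1 (f x)) = (\<integral>\<^sup>+s. indicator {0<..<1} s * indicator {x. s < f x} x \<partial>lborel)"
      by (cases "0 \<le> f x") (auto simp: ennreal_neg)
  qed
  also have "\<dots> = (\<integral>\<^sup>+s. (\<integral>\<^sup>+x. indicator {0<..<1} s * indicator {x. s < f x} x \<partial>lborel) \<partial>lborel)"
    by (rule lborel_pair.Fubini') simp
  also have "\<dots> = (\<integral>\<^sup>+s\<in>{0<..<1}. emeasure lborel {x. s < f x} \<partial>lborel)"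
    by (rule nn_integral_cong) (simp add: nn_integral_cmult mult.commute)
  finally show ?thesis .
qed

lemma quasiconcave_of_log_concave:
  fixes f :: "real \<Rightarrow> real"
  assumes "concave_on UNIV (\<lambda>x. ln (f x))" "\<And>x. 0 < f x"
  shows "convex {x. s < f x}"
  unfolding convex_alt
proof (intro ballI allI impI)
  fix x y u :: real assume xy: "x \<in> {x. s < f x}" "y \<in> {x. s < f x}" and u: "0 \<le> u \<and> u \<le> 1"
  have "min (ln (f x)) (ln (f y)) = (1 - u) * min (ln (f x)) (ln (f y)) + u * min (ln (f x)) (ln (f y))"
    by (simp add: algebra_simps)
  also have "\<dots> \<le> (1 - u) * ln (f x) + u * ln (f y)"
    using u by (intro add_mono mult_left_mono) auto
  also have "\<dots> \<le> ln (f ((1 - u) *\<^sub>R x + u *\<^sub>R y))"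
    using concave_onD[OF assms(1), of u x y] u by simp
  finally have "min (f x) (f y) \<le> f ((1 - u) *\<^sub>R x + u *\<^sub>R y)"
    using assms(2) by (auto simp: min_def split: if_splits)
  then show "(1 - u) *\<^sub>R x + u *\<^sub>R y \<in> {x. s < f x}" using xy by auto
qed

text \<open>With integral 0 a positive function would vanish almost everywhere, but the whole line
  is not a null set.\<close>

lemma integral_pos_lborel:
  fixes k :: "real \<Rightarrow> real"
  assumes "integrable lborel k" "\<And>x. 0 < k x"
  shows "0 < (\<integral>x. k x \<partial>lborel)"
proof -
  have "(\<integral>x. k x \<partial>lborel) \<noteq> 0"
    using assms by (subst integral_nonneg_eq_0_iff_AE)
      (auto simp: less_imp_le less_imp_neq[symmetric] AE_iff_measurable[where N = UNIV])
  moreover have "0 \<le> (\<integral>x. k x \<partial>lborel)" using assms by (simp add: less_imp_le)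
  ultimately show ?thesis by simp
qed

text \<open>After scaling \<^term>\<open>f\<close> and \<^term>\<open>g\<close> to supremum 1
  all their superlevel sets below height 1 are nonempty, so the one-dimensional Brunn-Minkowski
  inequality applies at every height; the superlevel sets of \<^term>\<open>h\<close> being intervals makes
  that inequality elementary.\<close>

lemma prekopa_leindler:
  fixes f g h :: "real \<Rightarrow> real" and l :: real
  assumes l: "0 < l" "l < 1"
    and pos: "\<And>x. 0 < f x" "\<And>x. 0 < g x" "\<And>x. 0 < h x"
    and bdd: "bdd_above (range f)" "bdd_above (range g)"
    and int: "integrable lborel f" "integrable lborel g" "integrable lborel h"
    and hconc: "concave_on UNIV (\<lambda>x. ln (h x))"
    and le: "\<And>a b. l * ln (f a) + (1 - l) * ln (g b) \<le> ln (h (l * a + (1 - l) * b))"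
  shows "l * ln (\<integral>x. f x \<partial>lborel) + (1 - l) * ln (\<integral>x. g x \<partial>lborel) \<le> ln (\<integral>x. h x \<partial>lborel)"
proof -
  define A where "A = Sup (range f)"
  define B where "B = Sup (range g)"
  \<comment> \<open>Dividing f by A and g by B lowers the left side of \<open>le\<close> by the
    exponent of C, so h has to be divided by this weighted geometric mean.\<close>
  define C where "C = exp (l * ln A + (1 - l) * ln B)"
  define F where "F x = f x / A" for x
  define G where "G x = g x / B" for x
  define H where "H x = h x / C" for x
  have fA: "f x \<le> A" and gB: "g x \<le> B" for x
    unfolding A_def B_def using bdd by (auto intro: cSup_upper)
  have A: "0 < A" and B: "0 < B" and C: "0 < C"
    using fA[of 0] gB[of 0] pos(1)[of 0] pos(2)[of 0] by (auto simp: C_def)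
  have [measurable]: "f \<in> borel_measurable borel" "g \<in> borel_measurable borel" "h \<in> borel_measurable borel"
    using int by auto
  have [measurable]: "F \<in> borel_measurable borel" "G \<in> borel_measurable borel" "H \<in> borel_measurable borel"
    unfolding F_def G_def H_def by measurable
  have Fpos: "0 < F x" and Gpos: "0 < G x" and Hpos: "0 < H x" for x
    using pos A B C by (auto simp: F_def G_def H_def)
  have F1: "F x \<le> 1" and G1: "G x \<le> 1" for x
    using fA gB A B by (auto simp: F_def G_def)
  have intFGH: "integrable lborel F" "integrable lborel G" "integrable lborel H"
    unfolding F_def G_def H_def using int by auto
  have lnFGH: "ln (F x) = ln (f x) - ln A" "ln (G x) = ln (g x) - ln B" "ln (H x) = ln (h x) - ln C" for x
    using pos[of x] A B C by (auto simp: F_def G_def H_def ln_div)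
  have leFGH: "l * ln (F a) + (1 - l) * ln (G b) \<le> ln (H (l * a + (1 - l) * b))" for a b
    using le[of a b] by (simp add: lnFGH C_def algebra_simps)
  have Hconc: "concave_on UNIV (\<lambda>x. ln (H x))"
  proof -
    have "concave_on UNIV (\<lambda>x. ln (h x) - ln C)"
      using hconc by (intro concave_on_diff) (auto simp: convex_on_const)
    then show ?thesis by (simp add: lnFGH)
  qed
  have level: "ennreal l * emeasure lborel {x. s < F x} + ennreal (1 - l) * emeasure lborel {x. s < G x}
      \<le> emeasure lborel {x. s < H x}" if s: "0 < s" "s < 1" for s
  proof (rule emeasure_convex_combination_le[OF l])
    have "s * A < A" "s * B < B" using s A B by auto
    then have "\<exists>x. s * A < f x" "\<exists>x. s * B < g x"
      using less_cSupD[of "range f" "s * A"] less_cSupD[of "range g" "s * B"] by (auto simp: A_def B_def)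
    then show "{x. s < F x} \<noteq> {}" "{x. s < G x} \<noteq> {}"
      using A B by (auto simp: F_def G_def field_simps)
    show "convex {x. s < H x}" using Hconc Hpos by (rule quasiconcave_of_log_concave)
    show "{x. s < H x} \<in> sets borel" by measurable
    have "emeasure lborel {x. s < H x} \<le> emeasure lborel {x\<in>space lborel. 1 \<le> ennreal (1/s) * ennreal (H x)}"
      using s Hpos by (intro emeasure_mono)
        (auto simp: ennreal_mult[symmetric] less_imp_le field_simps simp flip: ennreal_1)
    also have "\<dots> \<le> ennreal (1/s) * (\<integral>\<^sup>+x. ennreal (H x) * indicator UNIV x \<partial>lborel)"
      using nn_integral_Markov_inequality[of "\<lambda>x. ennreal (H x)" UNIV lborel "ennreal (1/s)"] by simp
    also have "\<dots> = ennreal (1/s) * ennreal (\<integral>x. H x \<partial>lborel)"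
      using intFGH(3) Hpos by (simp add: nn_integral_eq_integral less_imp_le)
    also have "\<dots> < \<infinity>" by (simp add: ennreal_mult_less_top)
    finally show "emeasure lborel {x. s < H x} < \<infinity>" .
    fix a b assume ab: "a \<in> {x. s < F x}" "b \<in> {x. s < G x}"
    have "ln s = l * ln s + (1 - l) * ln s" by (simp add: algebra_simps)
    also have "\<dots> < l * ln (F a) + (1 - l) * ln (G b)"
      using ab s l Fpos Gpos by (intro add_strict_mono mult_strict_left_mono) auto
    also have "\<dots> \<le> ln (H (l * a + (1 - l) * b))" by (rule leFGH)
    finally show "l * a + (1 - l) * b \<in> {x. s < H x}" using Hpos s by simp
  qed
  have "ennreal l * (\<integral>\<^sup>+x. F x \<partial>lborel) + ennreal (1 - l) * (\<integral>\<^sup>+x. G x \<partial>lborel)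
      = ennreal l * (\<integral>\<^sup>+x. min 1 (F x) \<partial>lborel) + ennreal (1 - l) * (\<integral>\<^sup>+x. min 1 (G x) \<partial>lborel)"
    using F1 G1 by (simp add: min_absorb2)
  also have "\<dots> = (\<integral>\<^sup>+s\<in>{0<..<1}. (ennreal l * emeasure lborel {x. s < F x}
        + ennreal (1 - l) * emeasure lborel {x. s < G x}) \<partial>lborel)"
    by (simp add: nn_integral_min_layer_cake nn_integral_add nn_integral_cmult distrib_right mult.assoc)
  also have "\<dots> \<le> (\<integral>\<^sup>+s\<in>{0<..<1}. emeasure lborel {x. s < H x} \<partial>lborel)"
    using level by (intro nn_integral_mono) (auto simp: indicator_def)
  also have "\<dots> = (\<integral>\<^sup>+x. min 1 (H x) \<partial>lborel)"
    by (simp add: nn_integral_min_layer_cake)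
  also have "\<dots> \<le> (\<integral>\<^sup>+x. H x \<partial>lborel)"
    by (intro nn_integral_mono ennreal_leI) auto
  finally have "ennreal (l * (\<integral>x. F x \<partial>lborel) + (1 - l) * (\<integral>x. G x \<partial>lborel)) \<le> ennreal (\<integral>x. H x \<partial>lborel)"
    using intFGH Fpos Gpos Hpos l
    by (simp add: nn_integral_eq_integral less_imp_le integral_nonneg_AE ennreal_mult' ennreal_plus)
  then have main: "l * (\<integral>x. F x \<partial>lborel) + (1 - l) * (\<integral>x. G x \<partial>lborel) \<le> (\<integral>x. H x \<partial>lborel)"
    using Hpos by (subst (asm) ennreal_le_iff) (auto intro!: integral_nonneg_AE simp: less_imp_le)
  \<comment> \<open>The level sets yield the arithmetic mean of the two integrals. Concavity of ln
    passes to the geometric mean, and the scaling constants cancel at the end.\<close>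
  have "l * ln (\<integral>x. F x \<partial>lborel) + (1 - l) * ln (\<integral>x. G x \<partial>lborel)
      \<le> ln (l * (\<integral>x. F x \<partial>lborel) + (1 - l) * (\<integral>x. G x \<partial>lborel))"
    using ln_concave l integral_pos_lborel[OF intFGH(1) Fpos] integral_pos_lborel[OF intFGH(2) Gpos] by (simp add: concave_on_iff)
  also have "\<dots> \<le> ln (\<integral>x. H x \<partial>lborel)"
    using main l integral_pos_lborel[OF intFGH(1) Fpos] integral_pos_lborel[OF intFGH(2) Gpos]
    by (intro ln_mono add_pos_pos mult_pos_pos) auto
  finally show ?thesis
    using A B C integral_pos_lborel[OF int(1) pos(1)] integral_pos_lborel[OF int(2) pos(2)] integral_pos_lborel[OF int(3) pos(3)]
    unfolding F_def G_def H_def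
    by (simp add: ln_div C_def algebra_simps)
qed

section \<open>Backward recursion of the Euler scheme\<close>

text \<open>Completing the square: the factor \<open>exp (a * z)\<close> turns the centred Gaussian
  into a multiple of the Gaussian with mean \<open>a * r\<^sup>2\<close>.\<close>

lemma has_bochner_integral_normal_exp:
  assumes "0 < r"
  shows "has_bochner_integral lborel (\<lambda>z. normal_density 0 r z * exp (a * z)) (exp (a\<^sup>2 * r\<^sup>2 / 2))"
proof -
  have "normal_density 0 r z * exp (a * z) = exp (a\<^sup>2 * r\<^sup>2 / 2) * normal_density (a * r\<^sup>2) r z" for z
  proof -
    have "- (z\<^sup>2 / (2 * r\<^sup>2)) + a * z = a\<^sup>2 * r\<^sup>2 / 2 - (z - a * r\<^sup>2)\<^sup>2 / (2 * r\<^sup>2)"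
      using assms by (simp add: field_simps power2_eq_square)
    then show ?thesis
      by (simp add: normal_density_def exp_add[symmetric] field_simps)
  qed
  then show ?thesis
    using has_bochner_integral_mult_right[OF has_bochner_integral_integrable[OF integrable_normal_density[OF assms, of "a * r\<^sup>2"]], of "exp (a\<^sup>2 * r\<^sup>2 / 2)"]
    by (simp add: assms)
qed

lemma exp_abs_le: "exp \<bar>x :: real\<bar> \<le> exp x + exp (- x)"
  by (cases "0 \<le> x") auto

text \<open>The bound in y has the same shape and the same rate c as the assumed bound on v, so it
  can be iterated. The summand \<open>ln 2\<close> counts the two exponentials that dominate
  \<open>exp \<bar>c * s * z\<bar>\<close>.\<close>

lemma integrable_normal_growth:
  fixes v :: "real \<Rightarrow> real"
  assumes h: "0 < h" and [measurable]: "v \<in> borel_measurable borel"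
    and v: "\<And>x. 0 \<le> v x" "\<And>x. v x \<le> exp (a + c * \<bar>x\<bar>)" and c: "0 \<le> c"
  shows "integrable lborel (\<lambda>z. normal_density 0 (sqrt h) z * v (y + s * z))" (is ?I)
    and "(\<integral>z. normal_density 0 (sqrt h) z * v (y + s * z) \<partial>lborel)
      \<le> exp (a + ln 2 + (c * s)\<^sup>2 * h / 2 + c * \<bar>y\<bar>)" (is ?B)
proof -
  let ?d = "\<lambda>z. exp (a + c * \<bar>y\<bar>) * (normal_density 0 (sqrt h) z * exp (c * s * z)
    + normal_density 0 (sqrt h) z * exp (- (c * s) * z))"
  have d: "has_bochner_integral lborel ?d (exp (a + c * \<bar>y\<bar>) * (exp ((c * s)\<^sup>2 * (sqrt h)\<^sup>2 / 2)
    + exp ((- (c * s))\<^sup>2 * (sqrt h)\<^sup>2 / 2)))"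
    by (intro has_bochner_integral_mult_right has_bochner_integral_add
        has_bochner_integral_normal_exp) (use h in auto)
  have le: "normal_density 0 (sqrt h) z * v (y + s * z) \<le> ?d z" for z
  proof -
    have "v (y + s * z) \<le> exp (a + c * \<bar>y\<bar> + \<bar>c * s * z\<bar>)"
      using v(2)[of "y + s * z"] mult_left_mono[OF abs_triangle_ineq[of y "s * z"] c] c
      by (auto simp: abs_mult algebra_simps intro: order_trans)
    also have "\<dots> \<le> exp (a + c * \<bar>y\<bar>) * (exp (c * s * z) + exp (- (c * s * z)))"
      using exp_abs_le[of "c * s * z"] by (simp add: exp_add)
    finally have "normal_density 0 (sqrt h) z * v (y + s * z) \<le> normal_density 0 (sqrt h) z *
        (exp (a + c * \<bar>y\<bar>) * (exp (c * s * z) + exp (- (c * s * z))))"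
      by (intro mult_left_mono) auto
    then show ?thesis by (simp add: algebra_simps)
  qed
  show I: ?I
  proof (rule Bochner_Integration.integrable_bound)
    show "integrable lborel ?d" using d by (simp add: has_bochner_integral_iff)
    show "AE z in lborel. norm (normal_density 0 (sqrt h) z * v (y + s * z)) \<le> norm (?d z)"
      using le v(1) by (auto intro!: AE_I2 simp: order_trans[OF _ abs_ge_self])
  qed measurable
  have "(\<integral>z. normal_density 0 (sqrt h) z * v (y + s * z) \<partial>lborel) \<le> (\<integral>z. ?d z \<partial>lborel)"
    using I d le by (intro integral_mono) (auto simp: has_bochner_integral_iff)
  also have "\<dots> = exp (a + ln 2 + (c * s)\<^sup>2 * h / 2 + c * \<bar>y\<bar>)"
    using d h by (simp add: has_bochner_integral_iff exp_add)
  finally show ?B .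
qed

text \<open>The growth bound keeps the Gaussian integrals of the backward recursion finite.\<close>

definition antimono_log_concave :: "(real \<Rightarrow> real) \<Rightarrow> bool" where
  "antimono_log_concave v \<longleftrightarrow> (\<forall>x. 0 < v x) \<and> antimono v \<and> concave_on UNIV (\<lambda>x. ln (v x))
     \<and> (\<exists>a c. 0 \<le> c \<and> (\<forall>x. v x \<le> exp (a + c * \<bar>x\<bar>)))"

lemma borel_measurable_antimono_log_concave [measurable_dest]:
  assumes "antimono_log_concave v"
  shows "v \<in> borel_measurable borel"
proof -
  have "(\<lambda>x. - v x) \<in> borel_measurable borel"
    using assms by (intro borel_measurable_mono) (auto simp: antimono_log_concave_def monotone_def)
  then show ?thesis by simp
qed

lemma antimono_log_concave_integrable:
  assumes "antimono_log_concave v" "0 < h"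
  shows "integrable lborel (\<lambda>z. normal_density 0 (sqrt h) z * v (y + s * z))"
proof -
  obtain a c where "0 \<le> c" "\<And>x. v x \<le> exp (a + c * \<bar>x\<bar>)"
    using assms(1) by (auto simp: antimono_log_concave_def)
  moreover have "0 \<le> v x" for x
    using assms(1) by (simp add: antimono_log_concave_def less_imp_le)
  ultimately show ?thesis
    using borel_measurable_antimono_log_concave[OF assms(1)] assms(2)
    by (intro integrable_normal_growth(1)[of h v a c])
qed

lemma ln_normal_density:
  "0 < r \<Longrightarrow> ln (normal_density 0 r z) = - z\<^sup>2 / (2 * r\<^sup>2) - ln (sqrt (2 * pi * r\<^sup>2))"
  by (simp add: normal_density_def ln_mult ln_div)

text \<open>Prekopa-Leindler is applied to the Gaussian-weighted functions of z belonging to x, to y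
  and to their mixture. Convexity puts \<phi> at the mixture below the mixture of its values, and
  antitone v turns this into the lower bound required of the third function. The factor
  \<open>exp (- h * x)\<close> adds only a linear term to the logarithm.\<close>

lemma antimono_log_concave_step:
  assumes v: "antimono_log_concave v" and h: "0 < h"
    and \<phi>: "convex_on UNIV \<phi>" "mono \<phi>" "\<And>x. \<bar>\<phi> x\<bar> \<le> K * (1 + \<bar>x\<bar>)"
  shows "antimono_log_concave (\<lambda>x. exp (- h * x) * (\<integral>z. normal_density 0 (sqrt h) z * v (\<phi> x + s * z) \<partial>lborel))"
proof -
  obtain a c where c: "0 \<le> c" and vle: "\<And>x. v x \<le> exp (a + c * \<bar>x\<bar>)"
    using v by (auto simp: antimono_log_concave_def)
  have vpos: "\<And>x. 0 < v x" and vanti: "antimono v" and vconc: "concave_on UNIV (\<lambda>x. ln (v x))"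
    using v by (auto simp: antimono_log_concave_def)
  have [measurable]: "v \<in> borel_measurable borel" using v by measurable
  define n where "n = normal_density 0 (sqrt h)"
  have npos: "0 < n z" for z unfolding n_def using h by (simp add: normal_density_pos)
  have lnn: "ln (n z) = - z\<^sup>2 / (2 * h) - ln (sqrt (2 * pi * h))" for z
    unfolding n_def using h by (subst ln_normal_density) auto
  define I where "I x = (\<integral>z. n z * v (\<phi> x + s * z) \<partial>lborel)" for x
  have int: "integrable lborel (\<lambda>z. n z * v (\<phi> x + s * z))" for x
    unfolding n_def by (rule antimono_log_concave_integrable[OF v h])
  have Ipos: "0 < I x" for x
    unfolding I_def using int npos vpos by (intro integral_pos_lborel) auto
  have Ianti: "antimono I"
    unfolding I_def
    by (intro antimonoI integral_mono int mult_left_mono antimonoD[OF vanti])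
      (use \<phi>(2) npos in \<open>auto simp: mono_def less_imp_le\<close>)
  have nconc: "concave_on UNIV (\<lambda>z. ln (n z))"
  proof -
    have "convex_on UNIV (\<lambda>z::real. z\<^sup>2 / (2 * h) + ln (sqrt (2 * pi * h)))"
      by (intro convex_on_add convex_on_cdiv convex_power2) (use h in \<open>auto simp: convex_on_const\<close>)
    then show ?thesis by (simp add: concave_on_def lnn algebra_simps)
  qed
  have bdd: "bdd_above (range (\<lambda>z. n z * v (\<phi> x + s * z)))" for x
  proof (rule bdd_aboveI2)
    fix z
    \<comment> \<open>The rate at which v can grow in z. The Gaussian exponent beats it: completing
      the square in \<bar>z\<bar> leaves an excess of at most
      \<open>k\<^sup>2 * h / 2\<close>.\<close>
    define k where "k = c * \<bar>s\<bar>"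
    have "ln (n z * v (\<phi> x + s * z)) \<le> ln (n z) + (a + c * (\<bar>\<phi> x\<bar> + \<bar>s\<bar> * \<bar>z\<bar>))"
    proof -
      have "ln (v (\<phi> x + s * z)) \<le> a + c * \<bar>\<phi> x + s * z\<bar>"
        using vle[of "\<phi> x + s * z"] vpos[of "\<phi> x + s * z"] by (metis ln_exp ln_mono)
      also have "\<dots> \<le> a + c * (\<bar>\<phi> x\<bar> + \<bar>s\<bar> * \<bar>z\<bar>)"
        using c by (intro add_left_mono mult_left_mono) (auto simp flip: abs_mult)
      finally show ?thesis using npos[of z] vpos[of "\<phi> x + s * z"] by (simp add: ln_mult)
    qed
    also have "\<dots> \<le> k\<^sup>2 * h / 2 - ln (sqrt (2 * pi * h)) + a + c * \<bar>\<phi> x\<bar>"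
    proof -
      have "k * \<bar>z\<bar> - z\<^sup>2 / (2 * h) = k\<^sup>2 * h / 2 - (\<bar>z\<bar> - k * h)\<^sup>2 / (2 * h)"
        using h by (simp add: field_simps power2_eq_square)
      moreover have "0 \<le> (\<bar>z\<bar> - k * h)\<^sup>2 / (2 * h)" using h by simp
      ultimately show ?thesis by (simp add: lnn k_def algebra_simps)
    qed
    finally show "n z * v (\<phi> x + s * z) \<le> exp (k\<^sup>2 * h / 2 - ln (sqrt (2 * pi * h)) + a + c * \<bar>\<phi> x\<bar>)"
      using npos[of z] vpos[of "\<phi> x + s * z"] by (metis exp_le_cancel_iff exp_ln mult_pos_pos)
  qed
  have lns: "ln (n z * v y) = ln (n z) + ln (v y)" for z y
    using npos[of z] vpos[of y] by (simp add: ln_mult)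
  have Iconc: "concave_on UNIV (\<lambda>x. ln (I x))"
  proof
    fix u x y :: real assume u: "0 < u" "u < 1"
    let ?m = "(1 - u) * x + u * y"
    have "(1 - u) * ln (I x) + (1 - (1 - u)) * ln (I y) \<le> ln (I ?m)"
      unfolding I_def
    proof (rule prekopa_leindler)
      show "concave_on UNIV (\<lambda>z. ln (n z * v (\<phi> ?m + s * z)))"
      proof -
        have "concave_on UNIV (\<lambda>z. ln (v (\<phi> ?m + s * z)))"
        proof
          fix t p q :: real assume t: "0 < t" "t < 1"
          have "\<phi> ?m + s * ((1 - t) *\<^sub>R p + t *\<^sub>R q) = (1 - t) *\<^sub>R (\<phi> ?m + s * p) + t *\<^sub>R (\<phi> ?m + s * q)"
            by (simp add: algebra_simps)
          then show "(1 - t) * ln (v (\<phi> ?m + s * p)) + t * ln (v (\<phi> ?m + s * q))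
              \<le> ln (v (\<phi> ?m + s * ((1 - t) *\<^sub>R p + t *\<^sub>R q)))"
            using concave_onD[OF vconc, of t "\<phi> ?m + s * p" "\<phi> ?m + s * q"] t by simp
        qed simp
        then show ?thesis unfolding lns by (intro concave_on_add nconc)
      qed
      fix p q
      have "\<phi> ?m \<le> (1 - u) * \<phi> x + u * \<phi> y"
        using convex_onD[OF \<phi>(1), of u x y] u by simp
      then have *: "\<phi> ?m + s * ((1 - u) * p + u * q) \<le> (1 - u) * (\<phi> x + s * p) + u * (\<phi> y + s * q)"
        by (simp add: algebra_simps)
      have "(1 - u) * ln (v (\<phi> x + s * p)) + u * ln (v (\<phi> y + s * q))
          \<le> ln (v ((1 - u) * (\<phi> x + s * p) + u * (\<phi> y + s * q)))"
        using concave_onD[OF vconc, of u "\<phi> x + s * p" "\<phi> y + s * q"] u by simp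
      also have "\<dots> \<le> ln (v (\<phi> ?m + s * ((1 - u) * p + u * q)))"
        using antimonoD[OF vanti *] vpos by (intro ln_mono) auto
      finally have "(1 - u) * ln (v (\<phi> x + s * p)) + u * ln (v (\<phi> y + s * q))
          \<le> ln (v (\<phi> ?m + s * ((1 - u) * p + u * q)))" .
      moreover have "(1 - u) * ln (n p) + u * ln (n q) \<le> ln (n ((1 - u) * p + u * q))"
        using concave_onD[OF nconc, of u p q] u by simp
      ultimately show "(1 - u) * ln (n p * v (\<phi> x + s * p)) + (1 - (1 - u)) * ln (n q * v (\<phi> y + s * q))
          \<le> ln (n ((1 - u) * p + (1 - (1 - u)) * q) * v (\<phi> ?m + s * ((1 - u) * p + (1 - (1 - u)) * q)))"
        unfolding lns by (simp add: algebra_simps)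
    qed (use u int bdd npos vpos in auto)
    then show "(1 - u) * ln (I x) + u * ln (I y) \<le> ln (I ((1 - u) *\<^sub>R x + u *\<^sub>R y))" by simp
  qed simp
  have K: "0 \<le> K" using \<phi>(3)[of 0] by simp
  have "exp (- h * x) * I x \<le> exp ((a + ln 2 + (c * s)\<^sup>2 * h / 2 + c * K) + (h + c * K) * \<bar>x\<bar>)" for x
  proof -
    have "I x \<le> exp (a + ln 2 + (c * s)\<^sup>2 * h / 2 + c * \<bar>\<phi> x\<bar>)"
      unfolding I_def n_def using h c vle vpos by (intro integrable_normal_growth(2)) (auto simp: less_imp_le)
    also have "\<dots> \<le> exp (a + ln 2 + (c * s)\<^sup>2 * h / 2 + c * (K * (1 + \<bar>x\<bar>)))"
      using \<phi>(3)[of x] c by (simp add: mult_left_mono)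
    finally have "exp (- h * x) * I x \<le> exp (h * \<bar>x\<bar>) * exp (a + ln 2 + (c * s)\<^sup>2 * h / 2 + c * (K * (1 + \<bar>x\<bar>)))"
      using Ipos[of x] h mult_left_mono[of "- x" "\<bar>x\<bar>" h]
      by (intro mult_mono) (auto simp: less_imp_le)
    also have "\<dots> = exp ((a + ln 2 + (c * s)\<^sup>2 * h / 2 + c * K) + (h + c * K) * \<bar>x\<bar>)"
      by (simp add: exp_add[symmetric] algebra_simps)
    finally show ?thesis .
  qed
  moreover have "0 \<le> h + c * K" using h c K by simp
  moreover have "concave_on UNIV (\<lambda>x. ln (exp (- h * x) * I x))"
  proof -
    have "convex_on UNIV (\<lambda>x::real. h * x)"
      using h by (intro convex_on_cmul) (auto simp: convex_on_ident)
    then have "concave_on UNIV (\<lambda>x. ln (I x) - h * x)"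
      by (intro concave_on_diff Iconc)
    then show ?thesis using Ipos by (simp add: ln_mult less_imp_neq[symmetric])
  qed
  moreover have "antimono (\<lambda>x. exp (- h * x) * I x)"
    using Ipos h by (intro antimonoI mult_mono) (auto simp: antimonoD[OF Ianti] less_imp_le)
  moreover have "0 < exp (- h * x) * I x" for x using Ipos by simp
  ultimately show ?thesis
    unfolding antimono_log_concave_def I_def[symmetric] n_def[symmetric] by blast
qed

text \<open>The value at step \<^term>\<open>k\<close> of the Euler scheme with \<^term>\<open>j\<close> steps still to go.\<close>

primrec euler_value :: "real \<Rightarrow> (nat \<Rightarrow> real \<Rightarrow> real) \<Rightarrow> (nat \<Rightarrow> real) \<Rightarrow> nat \<Rightarrow> nat \<Rightarrow> real \<Rightarrow> real" where
  "euler_value h b s 0 k x = 1"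
| "euler_value h b s (Suc j) k x = exp (- h * x) *
     (\<integral>z. normal_density 0 (sqrt h) z * euler_value h b s j (Suc k) ((x + h * b k x) + s k * z) \<partial>lborel)"

text \<open>By convexity, a chord of slope m > D would keep f above a line of slope m to the right
  of y, and that line eventually overtakes the growth bound.\<close>

lemma convex_linear_growth_slope_le:
  fixes f :: "real \<Rightarrow> real"
  assumes f: "convex_on UNIV f" "\<And>x. f x \<le> D * (1 + \<bar>x\<bar>)" and "x < y"
  shows "f y - f x \<le> D * (y - x)"
proof (rule ccontr)
  define m where "m = (f y - f x) / (y - x)"
  assume "\<not> ?thesis"
  then have mD: "0 < m - D" using \<open>x < y\<close> by (simp add: m_def field_simps)
  \<comment> \<open>Beyond y, so that the chord estimate applies, and beyond 0, so that
    \<bar>z\<bar> = z. The second term of the maximum makes \<open>(m - D) * z\<close> exceed its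
    upper bound by at least 1.\<close>
  define z where "z = max (max y 0 + 1) ((D - f x + m * x + 1) / (m - D))"
  have z: "y < z" "0 < z" by (auto simp: z_def less_max_iff_disj)
  have "m \<le> (f z - f x) / (z - x)"
    using convex_on_slope_le(1)[OF f(1) UNIV_I UNIV_I \<open>x < y\<close> z(1)] \<open>x < y\<close> z
    by (simp add: m_def divide_simps split: if_splits) (simp add: algebra_simps)
  then have "m * (z - x) \<le> f z - f x" using \<open>x < y\<close> z by (simp add: field_simps)
  then have "(m - D) * z \<le> D - f x + m * x"
    using f(2)[of z] z by (simp add: algebra_simps)
  moreover have "(D - f x + m * x + 1) / (m - D) \<le> z" by (simp add: z_def)
  then have "D - f x + m * x + 1 \<le> (m - D) * z" using mD by (simp add: field_simps)
  ultimately show False by linarith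
qed

text \<open>Reflecting f gives the bound on slopes from below. The growth constant itself is the
  Lipschitz constant, so a single constant serves for the drift at all times.\<close>

lemma convex_linear_growth_lipschitz:
  fixes f :: "real \<Rightarrow> real"
  assumes f: "convex_on UNIV f" "\<And>x. \<bar>f x\<bar> \<le> D * (1 + \<bar>x\<bar>)"
  shows "\<bar>f x - f y\<bar> \<le> D * \<bar>x - y\<bar>"
proof -
  have *: "\<bar>f x - f y\<bar> \<le> D * \<bar>x - y\<bar>" if "x < y" for x y
  proof -
    have up: "f x \<le> D * (1 + \<bar>x\<bar>)" for x using f(2)[of x] by simp
    have "convex_on UNIV (\<lambda>x. f (- x))"
    proof
      fix t a b :: real assume "0 < t" "t < 1"
      then show "f (- ((1 - t) *\<^sub>R a + t *\<^sub>R b)) \<le> (1 - t) * f (- a) + t * f (- b)"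
        using convex_onD[OF f(1), of t "- a" "- b"] by simp
    qed simp
    then have "f (- (- x)) - f (- (- y)) \<le> D * (- x - - y)"
      using that up[of "- _"] by (intro convex_linear_growth_slope_le) auto
    then show ?thesis
      using convex_linear_growth_slope_le[OF f(1) up that] that by (simp add: abs_le_iff algebra_simps)
  qed
  show ?thesis
    using *[of x y] *[of y x] by (cases x y rule: linorder_cases) (auto simp: abs_minus_commute)
qed

text \<open>The step restriction makes the Euler map monotone: the drift can fall at slope at most
  D, which h * D \<le> 1 compensates.\<close>

lemma euler_value_antimono_log_concave:
  assumes h: "0 < h" "h * D \<le> 1"
    and b: "\<And>k. convex_on UNIV (b k)" "\<And>k x. \<bar>b k x\<bar> \<le> D * (1 + \<bar>x\<bar>)"
  shows "antimono_log_concave (euler_value h b s j k)"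
proof (induction j arbitrary: k)
  case 0
  have "\<exists>a c. 0 \<le> c \<and> (\<forall>x::real. 1 \<le> exp (a + c * \<bar>x\<bar>))"
    by (rule exI[of _ 0], rule exI[of _ 0]) auto
  then show ?case by (simp add: antimono_log_concave_def antimono_def concave_on_const)
next
  case (Suc j)
  have D: "0 \<le> D" using b(2)[of 0 0] by simp
  have "convex_on UNIV (\<lambda>x. x + h * b k x)"
    using h b(1) by (intro convex_on_add convex_on_cmul) (auto simp: convex_on_ident)
  moreover have "mono (\<lambda>x. x + h * b k x)"
  proof (rule monoI)
    fix x y :: real assume "x \<le> y"
    have "h * \<bar>b k x - b k y\<bar> \<le> h * (D * \<bar>x - y\<bar>)"
      using h by (intro mult_left_mono convex_linear_growth_lipschitz b) auto
    also have "\<dots> \<le> y - x"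
      using h \<open>x \<le> y\<close> mult_right_mono[OF h(2), of "y - x"] by (simp add: algebra_simps)
    finally show "x + h * b k x \<le> y + h * b k y"
      using h mult_left_mono[OF abs_ge_self[of "b k x - b k y"], of h] by (simp add: algebra_simps)
  qed
  moreover have "\<bar>x + h * b k x\<bar> \<le> (1 + h * D) * (1 + \<bar>x\<bar>)" for x
  proof -
    have "\<bar>x + h * b k x\<bar> \<le> \<bar>x\<bar> + h * \<bar>b k x\<bar>"
      using h abs_triangle_ineq[of x "h * b k x"] by (simp add: abs_mult)
    also have "\<dots> \<le> \<bar>x\<bar> + h * (D * (1 + \<bar>x\<bar>))" using h b(2) by (simp add: mult_left_mono)
    finally show ?thesis by (simp add: algebra_simps)
  qed
  ultimately show ?case
    using antimono_log_concave_step[OF Suc[of "Suc k"] h(1), of "\<lambda>x. x + h * b k x" "1 + h * D" "s k"]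
    by (simp add: fun_eq_iff)
qed

section \<open>Riemann sums and the Euler scheme along a path\<close>

text \<open>The error is explicit for every k because the comparison with the Euler scheme needs the
  drift integral up to each grid point, not only up to the final time.\<close>

lemma riemann_sum_error:
  fixes g :: "real \<Rightarrow> real"
  assumes g: "continuous_on {t..u} g" and h: "0 \<le> h"
    and osc: "\<And>r r'. r \<in> {t..u} \<Longrightarrow> r' \<in> {t..u} \<Longrightarrow> \<bar>r - r'\<bar> \<le> h \<Longrightarrow> \<bar>g r - g r'\<bar> \<le> e"
  shows "t + real k * h \<le> u \<Longrightarrow>
    \<bar>integral {t..t + real k * h} g - h * (\<Sum>i<k. g (t + real i * h))\<bar> \<le> real k * h * e"
proof (induction k)
  case (Suc k)
  define p where "p = t + real k * h"
  have p: "t \<le> p" "p + h \<le> u" "t + real (Suc k) * h = p + h"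
    using Suc.prems h by (auto simp: p_def algebra_simps)
  have cont: "continuous_on {p..p + h} g" using p h by (intro continuous_on_subset[OF g]) auto
  have "norm (integral {p..p + h} (\<lambda>r. g r - g p)) \<le> e * (p + h - p)"
    using h p by (intro integral_bound continuous_intros cont) (auto intro!: osc)
  moreover have "integral {p..p + h} (\<lambda>r. g r - g p) = integral {p..p + h} g - h * g p"
    using h cont by (subst integral_diff) (auto intro: integrable_continuous_real)
  moreover have "integral {t..p + h} g = integral {t..p} g + integral {p..p + h} g"
    using p h by (intro Henstock_Kurzweil_Integration.integral_combine[symmetric] integrable_continuous_real
        continuous_on_subset[OF g]) auto
  moreover have "\<bar>integral {t..p} g - h * (\<Sum>i<k. g (t + real i * h))\<bar> \<le> real k * h * e"
    unfolding p_def using p h by (intro Suc.IH) (auto simp: p_def)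
  ultimately show ?case by (simp add: p(3)) (simp add: p_def algebra_simps)
qed simp

lemma eventually_oscillation_le:
  fixes g :: "real \<Rightarrow> real"
  assumes g: "continuous_on {t..u} g" and e: "0 < e" and f: "f \<longlonglongrightarrow> 0"
  shows "\<forall>\<^sub>F n in sequentially. \<forall>r\<in>{t..u}. \<forall>r'\<in>{t..u}. \<bar>r - r'\<bar> \<le> f n \<longrightarrow> \<bar>g r - g r'\<bar> \<le> (e::real)"
proof -
  have "uniformly_continuous_on {t..u} g" using g by (intro compact_uniformly_continuous) auto
  then obtain d where d: "0 < d" "\<And>r r'. r \<in> {t..u} \<Longrightarrow> r' \<in> {t..u} \<Longrightarrow> dist r' r < d \<Longrightarrow> dist (g r') (g r) < e"
    using e unfolding uniformly_continuous_on_def by metis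
  have "\<forall>\<^sub>F n in sequentially. f n < d" using f d(1) by (rule order_tendstoD)
  then show ?thesis
  proof eventually_elim
    case (elim n)
    show ?case
    proof (intro ballI impI)
      fix r r' assume r: "r \<in> {t..u}" "r' \<in> {t..u}" "\<bar>r - r'\<bar> \<le> f n"
      then have "dist r r' < d" using elim by (simp add: dist_real_def)
      from d(2)[OF r(2,1) this] show "\<bar>g r - g r'\<bar> \<le> e" by (simp add: dist_real_def)
    qed
  qed
qed

lemma riemann_sum_tendsto:
  fixes g :: "real \<Rightarrow> real"
  assumes g: "continuous_on {t..u} g" and "t \<le> u"
  shows "(\<lambda>n. (u - t) / real n * (\<Sum>i<n. g (t + real i * ((u - t) / real n)))) \<longlonglongrightarrow> integral {t..u} g"
proof (rule LIMSEQ_I)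
  fix e :: real assume e: "0 < e"
  \<comment> \<open>The summand 1 keeps the denominator positive when t = u.\<close>
  define e' where "e' = e / (2 * (u - t + 1))"
  have e': "0 < e'" "(u - t) * e' < e" using e \<open>t \<le> u\<close> mult_left_mono[of t u e]
    by (auto simp: e'_def divide_simps)
  have "(\<lambda>n. (u - t) / real n) \<longlonglongrightarrow> 0" by (rule lim_const_over_n)
  from eventually_oscillation_le[OF g e'(1) this] eventually_gt_at_top[of 0]
  have "\<forall>\<^sub>F n in sequentially. norm ((u - t) / real n * (\<Sum>i<n. g (t + real i * ((u - t) / real n)))
      - integral {t..u} g) < e"
  proof eventually_elim
    case (elim n)
    have "\<bar>integral {t..t + real n * ((u - t) / real n)} g
        - (u - t) / real n * (\<Sum>i<n. g (t + real i * ((u - t) / real n)))\<bar>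
        \<le> real n * ((u - t) / real n) * e'"
    proof (rule riemann_sum_error[OF g])
      show "0 \<le> (u - t) / real n" "t + real n * ((u - t) / real n) \<le> u"
        using elim(2) \<open>t \<le> u\<close> by auto
    qed (use elim(1) in blast)
    also have "\<dots> < e" using elim(2) e'(2) by simp
    finally show ?case using elim(2) by (simp add: abs_minus_commute)
  qed
  then show "\<exists>n0. \<forall>n\<ge>n0. norm ((u - t) / real n * (\<Sum>i<n. g (t + real i * ((u - t) / real n)))
      - integral {t..u} g) < e"
    by (simp add: eventually_sequentially)
qed

text \<open>The cumulative sums obey a linear one-step recursion and are bounded directly. Times the
  mesh size, they are what enters the time integral of a path.\<close>

lemma discrete_gronwall_sum:
  fixes d a :: "nat \<Rightarrow> real"
  assumes L: "0 \<le> L" and a: "\<And>k. k < n \<Longrightarrow> 0 \<le> a k"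
    and d: "\<And>k. k < n \<Longrightarrow> d k \<le> a k + L * (\<Sum>i<k. d i)"
  shows "k \<le> n \<Longrightarrow> (\<Sum>i<k. d i) \<le> (1 + L) ^ k * (\<Sum>i<k. a i)"
proof (induction k)
  case (Suc k)
  have "(\<Sum>i<Suc k. d i) \<le> (1 + L) * (\<Sum>i<k. d i) + a k"
    using d[of k] Suc.prems by (simp add: algebra_simps)
  also have "\<dots> \<le> (1 + L) * ((1 + L) ^ k * (\<Sum>i<k. a i)) + (1 + L) ^ Suc k * a k"
    using Suc L a[of k] mult_right_mono[OF one_le_power[of "1 + L" "Suc k"], of "a k"]
    by (intro add_mono mult_left_mono) auto
  also have "\<dots> = (1 + L) ^ Suc k * (\<Sum>i<Suc k. a i)" by (simp add: algebra_simps)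
  finally show ?case .
qed simp

text \<open>Since 1 + h * D \<le> \<open>exp (h * D)\<close>, the factor depends on the elapsed time
  n * h and not on the number of steps.\<close>

lemma gronwall_exp:
  fixes d a :: "nat \<Rightarrow> real"
  assumes h: "0 \<le> h" "0 \<le> D" and a: "\<And>k. k < n \<Longrightarrow> 0 \<le> a k"
    and d: "\<And>k. k < n \<Longrightarrow> d k \<le> a k + h * D * (\<Sum>i<k. d i)"
  shows "h * (\<Sum>i<n. d i) \<le> exp (D * (real n * h)) * (h * (\<Sum>i<n. a i))"
proof -
  have "(\<Sum>i<n. d i) \<le> (1 + h * D) ^ n * (\<Sum>i<n. a i)"
    using discrete_gronwall_sum[of "h * D" n a d n] h a d by simp
  also have "\<dots> \<le> exp (h * D) ^ n * (\<Sum>i<n. a i)"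
    using h a exp_ge_add_one_self[of "h * D"] by (intro mult_right_mono power_mono sum_nonneg) auto
  also have "exp (h * D) ^ n = exp (D * (real n * h))" by (simp add: exp_of_nat_mult[symmetric] mult_ac)
  finally have "(\<Sum>i<n. d i) \<le> exp (D * (real n * h)) * (\<Sum>i<n. a i)" .
  from mult_left_mono[OF this h(1)] show ?thesis by (simp add: mult_ac)
qed

text \<open>The noise is an arbitrary real sequence, which makes the path estimates deterministic.
  Probability enters when weighted Brownian increments are substituted for \<xi>.\<close>

primrec euler_path :: "real \<Rightarrow> (nat \<Rightarrow> real \<Rightarrow> real) \<Rightarrow> real \<Rightarrow> (nat \<Rightarrow> real) \<Rightarrow> nat \<Rightarrow> real" where
  "euler_path h b x \<xi> 0 = x"
| "euler_path h b x \<xi> (Suc k) = (euler_path h b x \<xi> k + h * b k (euler_path h b x \<xi> k)) + \<xi> k"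

lemma euler_path_eq_sum:
  "euler_path h b x \<xi> k = x + h * (\<Sum>i<k. b i (euler_path h b x \<xi> i)) + (\<Sum>i<k. \<xi> i)"
  by (induction k) (auto simp: algebra_simps)

text \<open>Linear growth and Gronwall reduce the path to the partial sums of its noise, whose
  exponential moments are available. This later bounds the Euler discount factors in mean
  square.\<close>

lemma euler_path_bound:
  assumes h: "0 \<le> h" and b: "\<And>k x. \<bar>b k x\<bar> \<le> D * (1 + \<bar>x\<bar>)"
  shows "h * (\<Sum>i<n. \<bar>euler_path h b x \<xi> i\<bar>) \<le> exp (D * (real n * h)) *
    (real n * h * (\<bar>x\<bar> + D * (real n * h)) + h * (\<Sum>i<n. \<bar>\<Sum>j<i. \<xi> j\<bar>))"
proof -
  let ?p = "euler_path h b x \<xi>"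
  have D: "0 \<le> D" using b[of 0 0] by simp
  have "h * (\<Sum>i<n. \<bar>?p i\<bar>) \<le> exp (D * (real n * h)) *
      (h * (\<Sum>i<n. (\<bar>x\<bar> + D * (real n * h)) + \<bar>\<Sum>j<i. \<xi> j\<bar>))"
  proof (rule gronwall_exp[OF h D])
    fix k assume "k < n"
    have "?p k = x + h * (\<Sum>i<k. b i (?p i)) + (\<Sum>i<k. \<xi> i)" by (rule euler_path_eq_sum)
    moreover have "\<bar>h * (\<Sum>i<k. b i (?p i))\<bar> = h * \<bar>\<Sum>i<k. b i (?p i)\<bar>"
      using h by (simp add: abs_mult)
    ultimately have "\<bar>?p k\<bar> \<le> \<bar>x\<bar> + h * \<bar>\<Sum>i<k. b i (?p i)\<bar> + \<bar>\<Sum>i<k. \<xi> i\<bar>" by linarith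
    also have "h * \<bar>\<Sum>i<k. b i (?p i)\<bar> \<le> h * (\<Sum>i<k. D * (1 + \<bar>?p i\<bar>))"
      using h by (intro mult_left_mono order_trans[OF sum_abs] sum_mono b)
    also have "\<dots> = D * (real k * h) + h * D * (\<Sum>i<k. \<bar>?p i\<bar>)"
      by (simp add: distrib_left sum.distrib sum_distrib_left mult_ac)
    also have "D * (real k * h) \<le> D * (real n * h)"
      using \<open>k < n\<close> D h by (intro mult_left_mono mult_right_mono) auto
    finally show "\<bar>?p k\<bar> \<le> \<bar>x\<bar> + D * (real n * h) + \<bar>\<Sum>j<k. \<xi> j\<bar> + h * D * (\<Sum>i<k. \<bar>?p i\<bar>)"
      by simp
  qed (use h D in auto)
  then show ?thesis by (simp add: sum.distrib algebra_simps)
qed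

text \<open>In the application Y is the exact path on the grid, w its stochastic part and \<rho> the
  quadrature error of the drift. As the noise does not depend on the state, its error enters as an
  inhomogeneity and not through the recursion.\<close>

lemma euler_path_error:
  assumes h: "0 \<le> h" and D: "0 \<le> D" and b: "\<And>k x y. \<bar>b k x - b k y\<bar> \<le> D * \<bar>x - y\<bar>" and \<rho>: "0 \<le> \<rho>"
    and Y: "\<And>k. k < n \<Longrightarrow> \<bar>Y k - (x + h * (\<Sum>i<k. b i (Y i)) + w k)\<bar> \<le> \<rho>"
  shows "h * (\<Sum>i<n. \<bar>Y i - euler_path h b x \<xi> i\<bar>) \<le> exp (D * (real n * h)) *
    (real n * h * \<rho> + h * (\<Sum>i<n. \<bar>(\<Sum>j<i. \<xi> j) - w i\<bar>))"
proof -
  let ?p = "euler_path h b x \<xi>"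
  have "h * (\<Sum>i<n. \<bar>Y i - ?p i\<bar>) \<le> exp (D * (real n * h)) *
      (h * (\<Sum>i<n. \<rho> + \<bar>(\<Sum>j<i. \<xi> j) - w i\<bar>))"
  proof (rule gronwall_exp[OF h D])
    fix k assume "k < n"
    have "Y k - ?p k = (Y k - (x + h * (\<Sum>i<k. b i (Y i)) + w k))
        + h * (\<Sum>i<k. b i (Y i) - b i (?p i)) + (w k - (\<Sum>j<k. \<xi> j))"
      by (subst euler_path_eq_sum) (simp add: sum_subtractf algebra_simps)
    moreover have "\<bar>h * (\<Sum>i<k. b i (Y i) - b i (?p i))\<bar> = h * \<bar>\<Sum>i<k. b i (Y i) - b i (?p i)\<bar>"
      using h by (simp add: abs_mult)
    ultimately have "\<bar>Y k - ?p k\<bar> \<le> \<rho> + h * \<bar>\<Sum>i<k. b i (Y i) - b i (?p i)\<bar> + \<bar>(\<Sum>j<k. \<xi> j) - w k\<bar>"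
      using Y[OF \<open>k < n\<close>] by linarith
    also have "h * \<bar>\<Sum>i<k. b i (Y i) - b i (?p i)\<bar> \<le> h * (\<Sum>i<k. D * \<bar>Y i - ?p i\<bar>)"
      using h by (intro mult_left_mono order_trans[OF sum_abs] sum_mono b)
    also have "\<dots> = h * D * (\<Sum>i<k. \<bar>Y i - ?p i\<bar>)" by (simp add: sum_distrib_left mult.assoc)
    finally show "\<bar>Y k - ?p k\<bar> \<le> \<rho> + \<bar>(\<Sum>j<k. \<xi> j) - w k\<bar> + h * D * (\<Sum>i<k. \<bar>Y i - ?p i\<bar>)"
      by simp
  qed (use \<rho> in auto)
  then show ?thesis by (simp add: sum.distrib algebra_simps)
qed

section \<open>Convergence in probability\<close>

text \<open>Almost sure convergence will be available only along subsequences; this recovers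
  convergence of the whole sequence of prices. A failure would give a subsequence that stays at
  distance at least e from l.\<close>

lemma tendsto_of_subsubsequences:
  fixes a :: "nat \<Rightarrow> 'a :: metric_space"
  assumes "\<And>r :: nat \<Rightarrow> nat. strict_mono r \<Longrightarrow> \<exists>r'. strict_mono r' \<and> (\<lambda>n. a (r (r' n))) \<longlonglongrightarrow> l"
  shows "a \<longlonglongrightarrow> l"
proof (rule ccontr)
  assume "\<not> a \<longlonglongrightarrow> l"
  then obtain e where e: "0 < e" "\<not> (\<forall>\<^sub>F n in sequentially. dist (a n) l < e)"
    by (auto simp: tendsto_iff)
  define S where "S = {n. e \<le> dist (a n) l}"
  have "infinite S"
  proof
    assume "finite S"
    then have "\<forall>\<^sub>F n in sequentially. n \<notin> S"
      by (simp add: eventually_cofinite flip: cofinite_eq_sequentially)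
    then show False using e(2) by (simp add: S_def not_le)
  qed
  then have r: "strict_mono (enumerate S)" "enumerate S n \<in> S" for n
    by (auto simp: strict_mono_enumerate enumerate_in_set)
  obtain r' where "strict_mono r'" "(\<lambda>n. a (enumerate S (r' n))) \<longlonglongrightarrow> l"
    using assms[OF r(1)] by blast
  then have "\<forall>\<^sub>F n in sequentially. dist (a (enumerate S (r' n))) l < e"
    using e(1) by (simp add: tendsto_iff)
  then obtain n where "dist (a (enumerate S (r' n))) l < e"
    by (meson eventually_sequentially order_refl)
  then show False using r(2)[of "r' n"] by (simp add: S_def)
qed

text \<open>Truncation at 1 turns convergence in probability into convergence in mean, from which an
  almost surely convergent subsequence can be extracted.\<close>

lemma (in prob_space) AE_subseq_of_convergence_in_probability:
  fixes u :: "nat \<Rightarrow> 'a \<Rightarrow> real"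
  assumes [measurable]: "\<And>n. u n \<in> borel_measurable M"
    and u: "\<And>e. 0 < e \<Longrightarrow> (\<lambda>n. measure M {\<omega>\<in>space M. \<bar>u n \<omega>\<bar> > e}) \<longlonglongrightarrow> 0"
  shows "\<exists>r::nat \<Rightarrow> nat. strict_mono r \<and> (AE \<omega> in M. (\<lambda>n. u (r n) \<omega>) \<longlonglongrightarrow> 0)"
proof -
  define v where "v n \<omega> = min 1 \<bar>u n \<omega>\<bar>" for n \<omega>
  have [measurable]: "v n \<in> borel_measurable M" for n unfolding v_def by measurable
  have int: "integrable M (v n)" for n
    by (rule integrable_const_bound[of _ 1]) (auto simp: v_def)
  have "(\<lambda>n. \<integral>\<omega>. norm (v n \<omega>) \<partial>M) \<longlonglongrightarrow> 0"
  proof (rule LIMSEQ_I)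
    fix e :: real assume e: "0 < e"
    have "\<forall>\<^sub>F n in sequentially. measure M {\<omega>\<in>space M. \<bar>u n \<omega>\<bar> > e / 2} < e / 2"
      using u[of "e / 2"] e by (intro order_tendstoD(2)) auto
    then have "\<forall>\<^sub>F n in sequentially. norm ((\<integral>\<omega>. norm (v n \<omega>) \<partial>M) - 0) < e"
    proof eventually_elim
      case (elim n)
      let ?S = "{\<omega>\<in>space M. \<bar>u n \<omega>\<bar> > e / 2}"
      have "(\<integral>\<omega>. norm (v n \<omega>) \<partial>M) \<le> (\<integral>\<omega>. e / 2 + indicator ?S \<omega> \<partial>M)"
        using int e by (intro integral_mono integrable_norm)
          (auto simp: v_def indicator_def intro!: integrable_const_bound[of _ "e / 2 + 1"])
      also have "\<dots> = e / 2 + measure M ?S"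
        by (subst Bochner_Integration.integral_add) (auto simp: prob_space intro!: integrable_const_bound[of _ 1])
      finally show ?case using elim by simp
    qed
    then show "\<exists>n0. \<forall>n\<ge>n0. norm ((\<integral>\<omega>. norm (v n \<omega>) \<partial>M) - 0) < e"
      by (simp add: eventually_sequentially)
  qed
  from tendsto_L1_AE_subseq[OF int this] obtain r :: "nat \<Rightarrow> nat" where r: "strict_mono r"
    and ae: "AE \<omega> in M. (\<lambda>n. v (r n) \<omega>) \<longlonglongrightarrow> 0" by blast
  from ae have "AE \<omega> in M. (\<lambda>n. u (r n) \<omega>) \<longlonglongrightarrow> 0"
  proof eventually_elim
    case (elim \<omega>)
    have "\<forall>\<^sub>F n in sequentially. v (r n) \<omega> < 1" using elim by (rule order_tendstoD) simp
    then have "\<forall>\<^sub>F n in sequentially. v (r n) \<omega> = \<bar>u (r n) \<omega>\<bar>"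
      by eventually_elim (auto simp: v_def)
    then have "(\<lambda>n. \<bar>u (r n) \<omega>\<bar>) \<longlonglongrightarrow> 0" using elim by (simp add: tendsto_cong)
    then show ?case by (simp add: tendsto_rabs_zero_iff)
  qed
  with r show ?thesis by blast
qed

lemma (in prob_space) AE_subseq_of_nn_integral_tendsto_0:
  fixes u :: "nat \<Rightarrow> 'a \<Rightarrow> real"
  assumes [measurable]: "\<And>n. u n \<in> borel_measurable M"
    and lim: "(\<lambda>n. \<integral>\<^sup>+\<omega>. ennreal \<bar>u n \<omega>\<bar> \<partial>M) \<longlonglongrightarrow> 0"
  shows "\<exists>r::nat \<Rightarrow> nat. strict_mono r \<and> (AE \<omega> in M. (\<lambda>n. u (r n) \<omega>) \<longlonglongrightarrow> 0)"
proof (rule AE_subseq_of_convergence_in_probability)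
  fix e :: real assume e: "0 < e"
  have markov: "ennreal (measure M {\<omega>\<in>space M. \<bar>u n \<omega>\<bar> > e}) \<le> ennreal (1 / e) * (\<integral>\<^sup>+\<omega>. ennreal \<bar>u n \<omega>\<bar> \<partial>M)" for n
  proof -
    have "ennreal (measure M {\<omega>\<in>space M. \<bar>u n \<omega>\<bar> > e}) = emeasure M {\<omega>\<in>space M. \<bar>u n \<omega>\<bar> > e}"
      by (simp add: emeasure_eq_measure)
    also have "\<dots> \<le> emeasure M {\<omega>\<in>space M. 1 \<le> ennreal (1 / e) * ennreal \<bar>u n \<omega>\<bar>}"
      using e by (intro emeasure_mono) (auto simp: field_simps simp flip: ennreal_mult ennreal_1)
    also have "\<dots> \<le> ennreal (1 / e) * (\<integral>\<^sup>+\<omega>. ennreal \<bar>u n \<omega>\<bar> * indicator (space M) \<omega> \<partial>M)"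
      by (rule nn_integral_Markov_inequality) auto
    also have "(\<integral>\<^sup>+\<omega>. ennreal \<bar>u n \<omega>\<bar> * indicator (space M) \<omega> \<partial>M) = (\<integral>\<^sup>+\<omega>. ennreal \<bar>u n \<omega>\<bar> \<partial>M)"
      by (rule nn_integral_cong) simp
    finally show ?thesis .
  qed
  have lim': "(\<lambda>n. ennreal (1 / e) * (\<integral>\<^sup>+\<omega>. ennreal \<bar>u n \<omega>\<bar> \<partial>M)) \<longlonglongrightarrow> 0"
    using ennreal_tendsto_cmult[OF _ lim, of "ennreal (1 / e)"] by simp
  show "(\<lambda>n. measure M {\<omega>\<in>space M. \<bar>u n \<omega>\<bar> > e}) \<longlonglongrightarrow> 0"
  proof (rule tendsto_ennrealD)
    show "(\<lambda>n. ennreal (measure M {\<omega>\<in>space M. \<bar>u n \<omega>\<bar> > e})) \<longlonglongrightarrow> ennreal 0"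
      unfolding ennreal_0
      by (rule tendsto_sandwich[OF _ _ tendsto_const lim']; rule eventuallyI, rule zero_le markov)
  qed simp_all
qed measurable

text \<open>Fatou's lemma along an almost surely convergent subsequence.\<close>

lemma (in prob_space) nn_integral_le_of_convergence_in_probability:
  fixes u :: "nat \<Rightarrow> 'a \<Rightarrow> real"
  assumes [measurable]: "\<And>n. u n \<in> borel_measurable M" "v \<in> borel_measurable M"
    and u: "\<And>e. 0 < e \<Longrightarrow> (\<lambda>n. measure M {\<omega>\<in>space M. \<bar>u n \<omega> - v \<omega>\<bar> > e}) \<longlonglongrightarrow> 0"
    and le: "\<And>n. (\<integral>\<^sup>+\<omega>. ennreal \<bar>u n \<omega>\<bar> \<partial>M) \<le> C"
  shows "(\<integral>\<^sup>+\<omega>. ennreal \<bar>v \<omega>\<bar> \<partial>M) \<le> C"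
proof -
  obtain r :: "nat \<Rightarrow> nat" where "AE \<omega> in M. (\<lambda>n. u (r n) \<omega> - v \<omega>) \<longlonglongrightarrow> 0"
    using AE_subseq_of_convergence_in_probability[of "\<lambda>n \<omega>. u n \<omega> - v \<omega>"] u by auto
  then have "AE \<omega> in M. ennreal \<bar>v \<omega>\<bar> \<le> liminf (\<lambda>n. ennreal \<bar>u (r n) \<omega>\<bar>)"
  proof eventually_elim
    case (elim \<omega>)
    then have "(\<lambda>n. ennreal \<bar>u (r n) \<omega>\<bar>) \<longlonglongrightarrow> ennreal \<bar>v \<omega>\<bar>"
      by (intro tendsto_ennrealI tendsto_rabs) (simp add: LIM_zero_iff)
    then show ?case using lim_imp_Liminf[OF sequentially_bot] by (metis order_refl)
  qed
  then have "(\<integral>\<^sup>+\<omega>. ennreal \<bar>v \<omega>\<bar> \<partial>M) \<le> (\<integral>\<^sup>+\<omega>. liminf (\<lambda>n. ennreal \<bar>u (r n) \<omega>\<bar>) \<partial>M)"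
    by (rule nn_integral_mono_AE)
  also have "\<dots> \<le> liminf (\<lambda>n. \<integral>\<^sup>+\<omega>. ennreal \<bar>u (r n) \<omega>\<bar> \<partial>M)"
    by (rule nn_integral_liminf) simp
  also have "\<dots> \<le> C" using le by (intro Liminf_le) auto
  finally show ?thesis .
qed

text \<open>Bounded second moments give uniform integrability, and Fatou's lemma passes the bound to
  g. The difference is capped at R: dominated convergence treats the capped part, and the excess is
  small uniformly in n.\<close>

lemma (in prob_space) integral_tendsto_of_square_bounded:
  fixes f :: "nat \<Rightarrow> 'a \<Rightarrow> real"
  assumes [measurable]: "\<And>n. f n \<in> borel_measurable M" "g \<in> borel_measurable M"
    and nonneg: "\<And>n \<omega>. 0 \<le> f n \<omega>" "\<And>\<omega>. 0 \<le> g \<omega>"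
    and lim: "AE \<omega> in M. (\<lambda>n. f n \<omega>) \<longlonglongrightarrow> g \<omega>"
    and K: "\<And>n. (\<integral>\<^sup>+\<omega>. ennreal ((f n \<omega>)\<^sup>2) \<partial>M) \<le> ennreal K" "0 \<le> K"
  shows "integrable M g" "\<And>n. integrable M (f n)" "(\<lambda>n. \<integral>\<omega>. f n \<omega> \<partial>M) \<longlonglongrightarrow> (\<integral>\<omega>. g \<omega> \<partial>M)"
proof -
  have gK: "(\<integral>\<^sup>+\<omega>. ennreal ((g \<omega>)\<^sup>2) \<partial>M) \<le> ennreal K"
  proof -
    have "AE \<omega> in M. ennreal ((g \<omega>)\<^sup>2) \<le> liminf (\<lambda>n. ennreal ((f n \<omega>)\<^sup>2))"
      using lim
    proof eventually_elim
      case (elim \<omega>)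
      then have "(\<lambda>n. ennreal ((f n \<omega>)\<^sup>2)) \<longlonglongrightarrow> ennreal ((g \<omega>)\<^sup>2)"
        by (intro tendsto_ennrealI tendsto_power)
      then show ?case using lim_imp_Liminf[OF sequentially_bot] by (metis order_refl)
    qed
    then have "(\<integral>\<^sup>+\<omega>. ennreal ((g \<omega>)\<^sup>2) \<partial>M) \<le> (\<integral>\<^sup>+\<omega>. liminf (\<lambda>n. ennreal ((f n \<omega>)\<^sup>2)) \<partial>M)"
      by (rule nn_integral_mono_AE)
    also have "\<dots> \<le> liminf (\<lambda>n. \<integral>\<^sup>+\<omega>. ennreal ((f n \<omega>)\<^sup>2) \<partial>M)"
      by (rule nn_integral_liminf) simp
    also have "\<dots> \<le> ennreal K" using K(1) by (intro Liminf_le) auto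
    finally show ?thesis .
  qed
  have sq: "integrable M (\<lambda>\<omega>. (k \<omega>)\<^sup>2)" "(\<integral>\<omega>. (k \<omega>)\<^sup>2 \<partial>M) \<le> K" "integrable M k"
    if [measurable]: "k \<in> borel_measurable M" and k: "(\<integral>\<^sup>+\<omega>. ennreal ((k \<omega>)\<^sup>2) \<partial>M) \<le> ennreal K" for k
  proof -
    show *: "integrable M (\<lambda>\<omega>. (k \<omega>)\<^sup>2)"
      using k by (intro integrableI_nonneg) (auto intro: le_less_trans)
    show "(\<integral>\<omega>. (k \<omega>)\<^sup>2 \<partial>M) \<le> K"
      using k K(2) by (simp add: nn_integral_eq_integral[OF *])
    show "integrable M k"
      by (rule square_integrable_imp_integrable[OF _ *]) simp
  qed
  note f = sq[OF assms(1) K(1)] and g = sq[OF assms(2) gK]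
  show "integrable M g" "\<And>n. integrable M (f n)" using f g by auto
  have diff: "integrable M (\<lambda>\<omega>. \<bar>f n \<omega> - g \<omega>\<bar>)" for n using f(3) g(3) by auto
  show "(\<lambda>n. \<integral>\<omega>. f n \<omega> \<partial>M) \<longlonglongrightarrow> (\<integral>\<omega>. g \<omega> \<partial>M)"
  proof (rule LIMSEQ_I)
    fix e :: real assume e: "0 < e"
    \<comment> \<open>Chosen so that 2 * K / R \<le> e / 2; taking K + 1 keeps R positive when K =
      0.\<close>
    define R where "R = 4 * (K + 1) / e"
    have R: "0 < R" using e K by (simp add: R_def)
    have "(\<lambda>n. \<integral>\<omega>. min \<bar>f n \<omega> - g \<omega>\<bar> R \<partial>M) \<longlonglongrightarrow> (\<integral>\<omega>. 0 \<partial>M)"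
    proof (rule integral_dominated_convergence[where w = "\<lambda>_. R"])
      show "AE \<omega> in M. (\<lambda>n. min \<bar>f n \<omega> - g \<omega>\<bar> R) \<longlonglongrightarrow> 0"
        using lim
      proof eventually_elim
        case (elim \<omega>)
        have "(\<lambda>n. \<bar>f n \<omega> - g \<omega>\<bar>) \<longlonglongrightarrow> 0"
          using elim by (simp add: tendsto_rabs_zero LIM_zero)
        then show ?case using tendsto_min[OF _ tendsto_const[of R], of "\<lambda>n. \<bar>f n \<omega> - g \<omega>\<bar>" 0] R
          by simp
      qed
    qed (use R in auto)
    then have "\<forall>\<^sub>F n in sequentially. (\<integral>\<omega>. min \<bar>f n \<omega> - g \<omega>\<bar> R \<partial>M) < e / 2"
      using e by (intro order_tendstoD(2)) auto
    then have "\<forall>\<^sub>F n in sequentially. norm ((\<integral>\<omega>. f n \<omega> \<partial>M) - (\<integral>\<omega>. g \<omega> \<partial>M)) < e"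
    proof eventually_elim
      case (elim n)
      have pt: "\<bar>f n \<omega> - g \<omega>\<bar> \<le> min \<bar>f n \<omega> - g \<omega>\<bar> R + ((f n \<omega>)\<^sup>2 + (g \<omega>)\<^sup>2) / R" for \<omega>
      proof (cases "\<bar>f n \<omega> - g \<omega>\<bar> \<le> R")
        case False
        have "R * \<bar>f n \<omega> - g \<omega>\<bar> \<le> \<bar>f n \<omega> - g \<omega>\<bar> * \<bar>f n \<omega> - g \<omega>\<bar>"
          using False by (intro mult_right_mono) auto
        also have "\<dots> \<le> (f n \<omega>)\<^sup>2 + (g \<omega>)\<^sup>2"
          using mult_nonneg_nonneg[OF nonneg(1)[of n \<omega>] nonneg(2)[of \<omega>]]
          by (simp add: power2_eq_square algebra_simps flip: abs_mult)
        finally have "\<bar>f n \<omega> - g \<omega>\<bar> \<le> ((f n \<omega>)\<^sup>2 + (g \<omega>)\<^sup>2) / R" using R by (simp add: field_simps)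
        then show ?thesis using R by simp
      qed (use R in auto)
      have "norm ((\<integral>\<omega>. f n \<omega> \<partial>M) - (\<integral>\<omega>. g \<omega> \<partial>M)) = \<bar>\<integral>\<omega>. f n \<omega> - g \<omega> \<partial>M\<bar>"
        using f(3) g(3) by simp
      also have "\<dots> \<le> (\<integral>\<omega>. \<bar>f n \<omega> - g \<omega>\<bar> \<partial>M)" by (rule integral_abs_bound)
      also have "\<dots> \<le> (\<integral>\<omega>. min \<bar>f n \<omega> - g \<omega>\<bar> R + ((f n \<omega>)\<^sup>2 + (g \<omega>)\<^sup>2) / R \<partial>M)"
        using diff f(1) g(1) pt by (intro integral_mono Bochner_Integration.integrable_add integrable_divide
            integrable_min integrable_const) auto
      also have "\<dots> = (\<integral>\<omega>. min \<bar>f n \<omega> - g \<omega>\<bar> R \<partial>M) + ((\<integral>\<omega>. (f n \<omega>)\<^sup>2 \<partial>M) + (\<integral>\<omega>. (g \<omega>)\<^sup>2 \<partial>M)) / R"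
        using diff f(1) g(1) by (simp add: integrable_min)
      also have "\<dots> < e / 2 + (K + K) / R"
        using elim f(2)[of n] g(2) R by (intro add_less_le_mono divide_right_mono add_mono) auto
      also have "(K + K) / R \<le> e / 2" using K(2) e by (simp add: R_def field_simps)
      finally show ?case by simp
    qed
    then show "\<exists>n0. \<forall>n\<ge>n0. norm ((\<integral>\<omega>. f n \<omega> \<partial>M) - (\<integral>\<omega>. g \<omega> \<partial>M)) < e"
      by (simp add: eventually_sequentially)
  qed
qed

section \<open>Sums of Brownian increments\<close>

lemma filtration_measurable_mono:
  assumes "is_filtration M F" "f \<in> measurable (F r) N" "0 \<le> r" "r \<le> r'"
  shows "f \<in> measurable (F r') N"
proof -
  have "space (F r) = space (F r')" "sets (F r) \<subseteq> sets (F r')"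
    using assms by (auto simp: is_filtration_def subalgebra_def)
  then show ?thesis using assms(2) by (auto simp: measurable_def)
qed

lemma filtration_measurable:
  assumes "is_filtration M F" "f \<in> measurable (F r) N" "0 \<le> r"
  shows "f \<in> measurable M N"
proof (rule measurable_from_subalg)
  show "subalgebra M (F r)" using assms(1,3) unfolding is_filtration_def by blast
qed fact

lemma brownian_motion_measurable:
  assumes "brownian_motion M F B" "is_filtration M F" "0 \<le> r" "r \<le> r'"
  shows "B r \<in> borel_measurable (F r')"
proof (rule filtration_measurable_mono)
  show "B r \<in> borel_measurable (F r)" using assms(1,3) unfolding brownian_motion_def by blast
qed fact+

text \<open>The freezing lemma: the increment is independent of \<open>F r\<close>, so the joint law
  of sample point and increment is a product, and Tonelli integrates the increment out with \<omega>
  held fixed. Taking \<omega> itself as first argument covers every functional that is measurable at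
  time r.\<close>

lemma nn_integral_brownian_increment:
  assumes "prob_space M" and filt: "is_filtration M F" and bm: "brownian_motion M F B"
    and r: "0 \<le> r" "r < r'" and G [measurable]: "G \<in> borel_measurable (F r \<Otimes>\<^sub>M borel)"
  shows "(\<integral>\<^sup>+\<omega>. G (\<omega>, B r' \<omega> - B r \<omega>) \<partial>M)
    = (\<integral>\<^sup>+\<omega>. (\<integral>\<^sup>+z. ennreal (normal_density 0 (sqrt (r' - r)) z) * G (\<omega>, z) \<partial>lborel) \<partial>M)"
proof -
  interpret prob_space M by fact
  \<comment> \<open>The sample point is viewed as a random element of the coarser sigma-algebra,
    because the product formula is known for events of \<open>F r\<close>.\<close>
  define N where "N = restr_to_subalg M (F r)"
  define Z where "Z \<omega> = B r' \<omega> - B r \<omega>" for \<omega>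
  have sub: "subalgebra M (F r)" using filt r by (simp add: is_filtration_def)
  have dist: "distributed M lborel Z (normal_density 0 (sqrt (r' - r)))"
    and ind: "\<And>A C. A \<in> sets (F r) \<Longrightarrow> C \<in> sets borel \<Longrightarrow>
      measure M (A \<inter> {\<omega>\<in>space M. Z \<omega> \<in> C}) = measure M A * measure M {\<omega>\<in>space M. Z \<omega> \<in> C}"
    using bm r unfolding brownian_motion_def Z_def by auto
  have [measurable]: "Z \<in> borel_measurable M"
    using dist by (simp add: distributed_def)
  have Ns: "sets N = sets (F r)" "space N = space M"
    using sub by (auto simp: N_def sets_restr_to_subalg space_restr_to_subalg)
  have id: "(\<lambda>\<omega>. \<omega>) \<in> measurable M N"
    using sub by (auto simp: measurable_def Ns subalgebra_def)
  interpret N: finite_measure N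
    unfolding N_def by (rule finite_measure_restr_to_subalg[OF sub]) (rule finite_measure_axioms)
  define P where "P = density lborel (\<lambda>z. ennreal (normal_density 0 (sqrt (r' - r)) z))"
  interpret P: prob_space P
    unfolding P_def using r by (intro prob_space_normal_density) simp
  have P: "P = distr M lborel Z" using dist by (simp add: P_def distributed_def)
  have [measurable]: "(\<lambda>\<omega>. (\<omega>, Z \<omega>)) \<in> measurable M (N \<Otimes>\<^sub>M P)"
    using id by (intro measurable_Pair) (auto simp: P)
  have [measurable]: "G \<in> borel_measurable (N \<Otimes>\<^sub>M P)"
    using G by (subst measurable_cong_sets[OF sets_pair_measure_cong[of N "F r" P borel]])
      (auto simp: Ns P_def)
  have "N \<Otimes>\<^sub>M P = distr M (N \<Otimes>\<^sub>M P) (\<lambda>\<omega>. (\<omega>, Z \<omega>))"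
  proof (rule pair_measure_eqI)
    fix A C assume A: "A \<in> sets N" and C: "C \<in> sets P"
    have A': "A \<in> sets (F r)" "A \<in> sets M" and C': "C \<in> sets borel"
      using A C sub by (auto simp: Ns P_def subalgebra_def)
    have "emeasure N A * emeasure P C = ennreal (measure M A) * ennreal (measure M {\<omega>\<in>space M. Z \<omega> \<in> C})"
      using A' C' sub by (auto simp: N_def P emeasure_restr_to_subalg emeasure_distr emeasure_eq_measure
          vimage_def Int_def conj_commute)
    also have "\<dots> = emeasure M (A \<inter> {\<omega>\<in>space M. Z \<omega> \<in> C})"
      using ind[OF A'(1) C'] by (simp add: emeasure_eq_measure ennreal_mult')
    also have "A \<inter> {\<omega>\<in>space M. Z \<omega> \<in> C} = (\<lambda>\<omega>. (\<omega>, Z \<omega>)) -` (A \<times> C) \<inter> space M"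
      using sets.sets_into_space[OF A'(2)] by auto
    finally show "emeasure N A * emeasure P C = emeasure (distr M (N \<Otimes>\<^sub>M P) (\<lambda>\<omega>. (\<omega>, Z \<omega>))) (A \<times> C)"
      using A C by (subst emeasure_distr) auto
  qed (auto intro: N.sigma_finite_measure_axioms P.sigma_finite_measure_axioms)
  note NP = this
  have "(\<integral>\<^sup>+\<omega>. G (\<omega>, Z \<omega>) \<partial>M) = (\<integral>\<^sup>+y. G y \<partial>distr M (N \<Otimes>\<^sub>M P) (\<lambda>\<omega>. (\<omega>, Z \<omega>)))"
    by (rule nn_integral_distr[symmetric]) measurable
  also have "\<dots> = (\<integral>\<^sup>+y. G y \<partial>(N \<Otimes>\<^sub>M P))"
    by (simp only: NP[symmetric])
  also have "\<dots> = (\<integral>\<^sup>+\<omega>. (\<integral>\<^sup>+z. G (\<omega>, z) \<partial>P) \<partial>N)"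
    by (rule P.nn_integral_fst[symmetric]) simp
  also have "\<dots> = (\<integral>\<^sup>+\<omega>. (\<integral>\<^sup>+z. G (\<omega>, z) \<partial>P) \<partial>M)"
  proof -
    have "(\<lambda>\<omega>. \<integral>\<^sup>+z. G (\<omega>, z) \<partial>P) \<in> borel_measurable N"
      by (rule P.borel_measurable_nn_integral_fst) fact
    then have "(\<lambda>\<omega>. \<integral>\<^sup>+z. G (\<omega>, z) \<partial>P) \<in> borel_measurable (F r)"
      by (subst (asm) measurable_cong_sets[OF Ns(1) refl])
    then show ?thesis unfolding N_def by (rule nn_integral_subalgebra2[OF sub])
  qed
  also have "\<dots> = (\<integral>\<^sup>+\<omega>. (\<integral>\<^sup>+z. ennreal (normal_density 0 (sqrt (r' - r)) z) * G (\<omega>, z) \<partial>lborel) \<partial>M)"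
  proof (rule nn_integral_cong)
    have nd: "(\<lambda>z. ennreal (normal_density 0 (sqrt (r' - r)) z)) \<in> borel_measurable lborel"
      by measurable
    fix \<omega> assume "\<omega> \<in> space M"
    then have "(\<lambda>z. G (\<omega>, z)) \<in> borel_measurable borel"
      using sub by (intro measurable_compose[OF measurable_Pair1' G]) (simp add: subalgebra_def)
    then have "(\<lambda>z. G (\<omega>, z)) \<in> borel_measurable lborel"
      by (subst measurable_cong_sets[OF sets_lborel refl])
    then show "(\<integral>\<^sup>+z. G (\<omega>, z) \<partial>P) = (\<integral>\<^sup>+z. ennreal (normal_density 0 (sqrt (r' - r)) z) * G (\<omega>, z) \<partial>lborel)"
      unfolding P_def by (rule nn_integral_density[OF nd])
  qed
  finally show ?thesis by (simp add: Z_def)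
qed

text \<open>The weights are deterministic, so peeling off the last increment leaves the sum of the
  earlier ones frozen and contributes one Gaussian factor.\<close>

lemma nn_integral_exp_brownian_sum:
  assumes M: "prob_space M" and filt: "is_filtration M F" and bm: "brownian_motion M F B"
    and t: "0 \<le> t" and h: "0 < h"
  shows "(\<integral>\<^sup>+\<omega>. ennreal (exp (\<Sum>k<n. c k * (B (t + real (Suc k) * h) \<omega> - B (t + real k * h) \<omega>))) \<partial>M)
    = ennreal (exp ((\<Sum>k<n. (c k)\<^sup>2) * h / 2))"
proof (induction n)
  case 0
  interpret prob_space M by fact
  show ?case by (simp add: emeasure_space_1)
next
  case (Suc n)
  define r where "r k = t + real k * h" for k
  define S where "S \<omega> = (\<Sum>k<n. c k * (B (r (Suc k)) \<omega> - B (r k) \<omega>))" for \<omega>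
  have r: "0 \<le> r k" "r n < r (Suc n)" "r (Suc n) - r n = h" for k
    using t h by (auto simp: r_def algebra_simps)
  have rmono: "k \<le> n \<Longrightarrow> r k \<le> r n" for k using h by (simp add: r_def)
  have [measurable]: "B (r k) \<in> borel_measurable (F (r n))" if "k \<le> n" for k
    using rmono[OF that] r(1) by (intro brownian_motion_measurable[OF bm filt]) auto
  have [measurable]: "S \<in> borel_measurable (F (r n))"
    unfolding S_def by (intro borel_measurable_sum) auto
  have [measurable]: "S \<in> borel_measurable M"
    by (rule filtration_measurable[OF filt _ r(1)[of n]]) measurable
  have "(\<integral>\<^sup>+\<omega>. ennreal (exp (\<Sum>k<Suc n. c k * (B (r (Suc k)) \<omega> - B (r k) \<omega>))) \<partial>M)
      = (\<integral>\<^sup>+\<omega>. (\<lambda>(\<omega>, z). ennreal (exp (S \<omega>)) * ennreal (exp (c n * z))) (\<omega>, B (r (Suc n)) \<omega> - B (r n) \<omega>) \<partial>M)"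
    by (simp add: S_def exp_add ennreal_mult)
  also have "\<dots> = (\<integral>\<^sup>+\<omega>. (\<integral>\<^sup>+z. ennreal (normal_density 0 (sqrt h) z) *
      (ennreal (exp (S \<omega>)) * ennreal (exp (c n * z))) \<partial>lborel) \<partial>M)"
    by (subst nn_integral_brownian_increment[OF M filt bm r(1,2)]) (auto simp: r(3))
  also have "\<dots> = (\<integral>\<^sup>+\<omega>. ennreal (exp (S \<omega>)) * ennreal (exp ((c n)\<^sup>2 * h / 2)) \<partial>M)"
  proof (rule nn_integral_cong)
    fix \<omega>
    have "(\<integral>\<^sup>+z. ennreal (normal_density 0 (sqrt h) z * exp (c n * z)) \<partial>lborel)
        = ennreal (exp ((c n)\<^sup>2 * (sqrt h)\<^sup>2 / 2))"
      using has_bochner_integral_normal_exp[of "sqrt h" "c n"] h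
      by (subst nn_integral_eq_integral) (auto simp: has_bochner_integral_iff)
    moreover have "(\<integral>\<^sup>+z. ennreal (normal_density 0 (sqrt h) z) *
        (ennreal (exp (S \<omega>)) * ennreal (exp (c n * z))) \<partial>lborel)
        = ennreal (exp (S \<omega>)) * (\<integral>\<^sup>+z. ennreal (normal_density 0 (sqrt h) z * exp (c n * z)) \<partial>lborel)"
      by (subst nn_integral_cmult[symmetric]) (auto simp: ennreal_mult mult_ac)
    ultimately show "(\<integral>\<^sup>+z. ennreal (normal_density 0 (sqrt h) z) *
        (ennreal (exp (S \<omega>)) * ennreal (exp (c n * z))) \<partial>lborel)
        = ennreal (exp (S \<omega>)) * ennreal (exp ((c n)\<^sup>2 * h / 2))" using h by simp
  qed
  also have "\<dots> = (\<integral>\<^sup>+\<omega>. ennreal (exp (S \<omega>)) \<partial>M) * ennreal (exp ((c n)\<^sup>2 * h / 2))"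
    by (rule nn_integral_multc) measurable
  also have "(\<integral>\<^sup>+\<omega>. ennreal (exp (S \<omega>)) \<partial>M) = ennreal (exp ((\<Sum>k<n. (c k)\<^sup>2) * h / 2))"
    unfolding S_def r_def by (rule Suc.IH)
  finally show ?case
    by (simp add: r_def ennreal_mult[symmetric] exp_add[symmetric] distrib_right add_divide_distrib)
qed

text \<open>Estimating \<open>exp \<bar>x\<bar>\<close> by the sum of the exponentials of x and -x
  accounts for the factor 2. The mesh enters the bound through the total length n * h alone, so the
  bound is stable under refinement.\<close>

lemma nn_integral_exp_abs_brownian_sum:
  assumes M: "prob_space M" and filt: "is_filtration M F" and bm: "brownian_motion M F B"
    and t: "0 \<le> t" and h: "0 < h" and c: "\<And>k. k < n \<Longrightarrow> \<bar>c k\<bar> \<le> e"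
  shows "(\<integral>\<^sup>+\<omega>. ennreal (exp \<bar>\<theta> * (\<Sum>k<n. c k * (B (t + real (Suc k) * h) \<omega> - B (t + real k * h) \<omega>))\<bar>) \<partial>M)
    \<le> ennreal (2 * exp (\<theta>\<^sup>2 * e\<^sup>2 * (real n * h) / 2))"
proof -
  define S where "S \<theta> \<omega> = (\<Sum>k<n. \<theta> * c k * (B (t + real (Suc k) * h) \<omega> - B (t + real k * h) \<omega>))" for \<theta> \<omega>
  have [measurable]: "B (t + real k * h) \<in> borel_measurable M" for k
    using t h by (intro filtration_measurable[OF filt, of _ "t + real k * h"] brownian_motion_measurable[OF bm filt]) auto
  have [measurable]: "S \<theta> \<in> borel_measurable M" for \<theta>
    unfolding S_def by measurable
  have S: "(\<integral>\<^sup>+\<omega>. ennreal (exp (S a \<omega>)) \<partial>M) \<le> ennreal (exp (a\<^sup>2 * e\<^sup>2 * (real n * h) / 2))" for a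
  proof -
    have "(\<Sum>k<n. (a * c k)\<^sup>2) \<le> (\<Sum>k<n. a\<^sup>2 * e\<^sup>2)"
    proof (rule sum_mono)
      fix k assume "k \<in> {..<n}"
      then have "\<bar>c k\<bar>\<^sup>2 \<le> e\<^sup>2" using c by (intro power_mono) auto
      then show "(a * c k)\<^sup>2 \<le> a\<^sup>2 * e\<^sup>2" by (simp add: power_mult_distrib mult_left_mono)
    qed
    then have "(\<Sum>k<n. (a * c k)\<^sup>2) * h \<le> a\<^sup>2 * e\<^sup>2 * (real n * h)"
      using h mult_right_mono[of "\<Sum>k<n. (a * c k)\<^sup>2" "real n * (a\<^sup>2 * e\<^sup>2)" h] by (simp add: mult_ac)
    then show ?thesis
      unfolding S_def nn_integral_exp_brownian_sum[OF M filt bm t h] by (intro ennreal_leI) simp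
  qed
  have "(\<integral>\<^sup>+\<omega>. ennreal (exp \<bar>S \<theta> \<omega>\<bar>) \<partial>M) \<le> (\<integral>\<^sup>+\<omega>. ennreal (exp (S \<theta> \<omega>)) + ennreal (exp (S (- \<theta>) \<omega>)) \<partial>M)"
    using exp_abs_le by (intro nn_integral_mono)
      (auto simp: S_def sum_negf simp flip: ennreal_plus intro!: ennreal_leI)
  also have "\<dots> = (\<integral>\<^sup>+\<omega>. ennreal (exp (S \<theta> \<omega>)) \<partial>M) + (\<integral>\<^sup>+\<omega>. ennreal (exp (S (- \<theta>) \<omega>)) \<partial>M)"
    by (rule nn_integral_add) auto
  also have "\<dots> \<le> ennreal (exp (\<theta>\<^sup>2 * e\<^sup>2 * (real n * h) / 2)) + ennreal (exp ((- \<theta>)\<^sup>2 * e\<^sup>2 * (real n * h) / 2))"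
    by (intro add_mono S)
  also have "\<dots> = ennreal (2 * exp (\<theta>\<^sup>2 * e\<^sup>2 * (real n * h) / 2))"
    by (simp flip: ennreal_plus)
  finally show ?thesis by (simp add: S_def sum_distrib_left mult.assoc)
qed

lemma nn_integral_abs_brownian_sum:
  assumes M: "prob_space M" and filt: "is_filtration M F" and bm: "brownian_motion M F B"
    and t: "0 \<le> t" and h: "0 < h" and c: "\<And>k. k < n \<Longrightarrow> \<bar>c k\<bar> \<le> e" and e: "0 < e"
    and n: "real n * h \<le> \<tau>" "0 < \<tau>"
  shows "(\<integral>\<^sup>+\<omega>. ennreal \<bar>\<Sum>k<n. c k * (B (t + real (Suc k) * h) \<omega> - B (t + real k * h) \<omega>)\<bar> \<partial>M)
    \<le> ennreal (e * (2 * sqrt \<tau> * exp 1))"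
proof -
  define S where "S \<omega> = (\<Sum>k<n. c k * (B (t + real (Suc k) * h) \<omega> - B (t + real k * h) \<omega>))" for \<omega>
  have [measurable]: "B (t + real k * h) \<in> borel_measurable M" for k
    using t h by (intro filtration_measurable[OF filt, of _ "t + real k * h"] brownian_motion_measurable[OF bm filt]) auto
  have [measurable]: "S \<in> borel_measurable M" unfolding S_def by measurable
  \<comment> \<open>The scale of the standard deviation. Dividing by w brings the exponent of the
    moment bound below 1, and multiplying back makes the result linear in e.\<close>
  define w where "w = e * sqrt \<tau>"
  have w: "0 < w" using e n by (simp add: w_def)
  have "(\<integral>\<^sup>+\<omega>. ennreal \<bar>S \<omega>\<bar> \<partial>M) \<le> (\<integral>\<^sup>+\<omega>. ennreal w * ennreal (exp \<bar>(1 / w) * S \<omega>\<bar>) \<partial>M)"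
  proof (rule nn_integral_mono)
    fix \<omega>
    have "\<bar>S \<omega>\<bar> = w * \<bar>(1 / w) * S \<omega>\<bar>" using w by (simp add: abs_mult)
    also have "\<dots> \<le> w * exp \<bar>(1 / w) * S \<omega>\<bar>"
      using w exp_ge_add_one_self[of "\<bar>(1 / w) * S \<omega>\<bar>"] by (intro mult_left_mono) linarith+
    finally show "ennreal \<bar>S \<omega>\<bar> \<le> ennreal w * ennreal (exp \<bar>(1 / w) * S \<omega>\<bar>)"
      using w by (simp flip: ennreal_mult)
  qed
  also have "\<dots> = ennreal w * (\<integral>\<^sup>+\<omega>. ennreal (exp \<bar>(1 / w) * S \<omega>\<bar>) \<partial>M)"
    by (rule nn_integral_cmult) measurable
  also have "\<dots> \<le> ennreal w * ennreal (2 * exp ((1 / w)\<^sup>2 * e\<^sup>2 * (real n * h) / 2))"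
    unfolding S_def by (intro mult_left_mono nn_integral_exp_abs_brownian_sum[OF M filt bm t h] c) auto
  also have "\<dots> \<le> ennreal w * ennreal (2 * exp 1)"
  proof -
    have "(1 / w)\<^sup>2 * e\<^sup>2 * (real n * h) / 2 = real n * h / \<tau> / 2"
      using e n by (simp add: w_def power_divide power_mult_distrib)
    also have "\<dots> \<le> 1" using n by (simp add: field_simps)
    finally show ?thesis by (intro mult_left_mono ennreal_leI) auto
  qed
  also have "\<dots> = ennreal (e * (2 * sqrt \<tau> * exp 1))"
    using w by (simp add: w_def mult_ac flip: ennreal_mult)
  finally show ?thesis by (simp add: S_def)
qed

section \<open>The expected Euler discount factor as a backward recursion\<close>

lemma euler_path_measurable:
  assumes "\<And>i. i < k \<Longrightarrow> \<xi> i \<in> borel_measurable N" and [measurable]: "\<And>k. b k \<in> borel_measurable borel"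
  shows "(\<lambda>\<omega>. euler_path h b x (\<lambda>i. \<xi> i \<omega>) k) \<in> borel_measurable N"
  using assms(1)
proof (induction k)
  case (Suc k)
  have [measurable]: "\<xi> k \<in> borel_measurable N" by (rule Suc.prems) simp
  have [measurable]: "(\<lambda>\<omega>. euler_path h b x (\<lambda>i. \<xi> i \<omega>) k) \<in> borel_measurable N"
    by (rule Suc.IH) (simp add: Suc.prems)
  show ?case by simp
qed simp

text \<open>A discrete Feynman-Kac formula. The discount accumulated so far, times the remaining
  value at the current state, has the same expectation at every step; steps n and 0 give the two
  sides.\<close>

lemma nn_integral_euler_path:
  assumes M: "prob_space M" and filt: "is_filtration M F" and bm: "brownian_motion M F B"
    and t: "0 \<le> t" and h: "0 < h" "h * D \<le> 1"
    and b: "\<And>k. convex_on UNIV (b k)" "\<And>k x. \<bar>b k x\<bar> \<le> D * (1 + \<bar>x\<bar>)"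
    and p_def: "\<And>k \<omega>. p k \<omega> = euler_path h b x
        (\<lambda>k. s k * (B (t + real (Suc k) * h) \<omega> - B (t + real k * h) \<omega>)) k"
  shows "(\<integral>\<^sup>+\<omega>. ennreal (exp (- (h * (\<Sum>i<n. p i \<omega>)))) \<partial>M) = ennreal (euler_value h b s n 0 x)"
proof -
  define r where "r k = t + real k * h" for k
  have r: "0 \<le> r k" "r k < r (Suc k)" "r (Suc k) - r k = h" for k
    using t h by (auto simp: r_def algebra_simps)
  have rmono: "k \<le> n \<Longrightarrow> r k \<le> r n" for k n using h by (simp add: r_def)
  have v: "antimono_log_concave (euler_value h b s j k)" for j k
    using h b by (rule euler_value_antimono_log_concave)
  have vpos: "0 < euler_value h b s j k y" for j k y
    using v[of j k] by (simp add: antimono_log_concave_def)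
  have [measurable]: "euler_value h b s j k \<in> borel_measurable borel" for j k
    by (rule borel_measurable_antimono_log_concave[OF v])
  have [measurable]: "b k \<in> borel_measurable borel" for k
    using b(1)[of k] by (intro borel_measurable_continuous_onI convex_on_continuous) auto
  have pSuc: "p (Suc k) \<omega> = (p k \<omega> + h * b k (p k \<omega>)) + s k * (B (r (Suc k)) \<omega> - B (r k) \<omega>)" for k \<omega>
    by (simp add: p_def r_def)
  have pm: "p k \<in> borel_measurable (F (r k))" for k
    unfolding p_def[abs_def] r_def[symmetric]
  proof (rule euler_path_measurable)
    fix i assume "i < k"
    then have "r i \<le> r k" "r (Suc i) \<le> r k" by (auto intro!: rmono)
    then have [measurable]: "B (r i) \<in> borel_measurable (F (r k))" "B (r (Suc i)) \<in> borel_measurable (F (r k))"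
      by (auto intro!: brownian_motion_measurable[OF bm filt] r(1))
    show "(\<lambda>\<omega>. s i * (B (r (Suc i)) \<omega> - B (r i) \<omega>)) \<in> borel_measurable (F (r k))" by measurable
  qed measurable
  have main: "(\<integral>\<^sup>+\<omega>. ennreal (exp (- (h * (\<Sum>i<k. p i \<omega>))) * euler_value h b s (n - k) k (p k \<omega>)) \<partial>M)
      = ennreal (euler_value h b s n 0 x)" if "k \<le> n" for k
    using that
  proof (induction k)
    case 0
    interpret prob_space M by fact
    show ?case by (simp add: p_def emeasure_space_1)
  next
    case (Suc k)
    define j where "j = n - Suc k"
    have nk: "n - k = Suc j" using Suc.prems by (simp add: j_def)
    have pmk: "p i \<in> borel_measurable (F (r k))" if "i \<le> k" for i
      using filtration_measurable_mono[OF filt pm r(1) rmono[OF that]] by simp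
    \<comment> \<open>Includes the summand i = k: the recursion discounts at the left endpoint,
      before the next increment, so this factor is already known at time \<open>r k\<close>.\<close>
    define E where "E \<omega> = exp (- (h * (\<Sum>i<Suc k. p i \<omega>)))" for \<omega>
    have [measurable]: "p k \<in> borel_measurable (F (r k))" by (rule pm)
    have [measurable]: "E \<in> borel_measurable (F (r k))"
      proof -
      have "(\<lambda>\<omega>. \<Sum>i<Suc k. p i \<omega>) \<in> borel_measurable (F (r k))"
        by (intro borel_measurable_sum pmk) auto
      then show ?thesis unfolding E_def by measurable
    qed
    have "(\<integral>\<^sup>+\<omega>. ennreal (exp (- (h * (\<Sum>i<Suc k. p i \<omega>))) * euler_value h b s (n - Suc k) (Suc k) (p (Suc k) \<omega>)) \<partial>M)
        = (\<integral>\<^sup>+\<omega>. (\<lambda>(\<omega>, z). ennreal (E \<omega> * euler_value h b s j (Suc k) ((p k \<omega> + h * b k (p k \<omega>)) + s k * z)))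
            (\<omega>, B (r (Suc k)) \<omega> - B (r k) \<omega>) \<partial>M)"
      by (simp add: E_def j_def pSuc)
    also have "\<dots> = (\<integral>\<^sup>+\<omega>. (\<integral>\<^sup>+z. ennreal (normal_density 0 (sqrt h) z) *
        ennreal (E \<omega> * euler_value h b s j (Suc k) ((p k \<omega> + h * b k (p k \<omega>)) + s k * z)) \<partial>lborel) \<partial>M)"
      by (subst nn_integral_brownian_increment[OF M filt bm r(1,2)]) (auto simp: r(3))
    also have "\<dots> = (\<integral>\<^sup>+\<omega>. ennreal (exp (- (h * (\<Sum>i<k. p i \<omega>))) * euler_value h b s (n - k) k (p k \<omega>)) \<partial>M)"
    proof (rule nn_integral_cong)
      fix \<omega>
      let ?y = "p k \<omega> + h * b k (p k \<omega>)"
      have Epos: "0 < E \<omega>" by (simp add: E_def)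
      have int: "integrable lborel (\<lambda>z. normal_density 0 (sqrt h) z * euler_value h b s j (Suc k) (?y + s k * z))"
        by (rule antimono_log_concave_integrable[OF v h(1)])
      have "(\<integral>\<^sup>+z. ennreal (normal_density 0 (sqrt h) z) * ennreal (E \<omega> * euler_value h b s j (Suc k) (?y + s k * z)) \<partial>lborel)
          = (\<integral>\<^sup>+z. ennreal (E \<omega>) * ennreal (normal_density 0 (sqrt h) z * euler_value h b s j (Suc k) (?y + s k * z)) \<partial>lborel)"
        using Epos vpos by (intro nn_integral_cong) (simp add: less_imp_le mult_ac flip: ennreal_mult)
      also have "\<dots> = ennreal (E \<omega>) * (\<integral>\<^sup>+z. ennreal (normal_density 0 (sqrt h) z * euler_value h b s j (Suc k) (?y + s k * z)) \<partial>lborel)"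
        by (rule nn_integral_cmult) measurable
      also have "\<dots> = ennreal (E \<omega> * (\<integral>z. normal_density 0 (sqrt h) z * euler_value h b s j (Suc k) (?y + s k * z) \<partial>lborel))"
        using int vpos Epos by (subst nn_integral_eq_integral) (auto simp: less_imp_le ennreal_mult')
      also have "\<dots> = ennreal (exp (- (h * (\<Sum>i<k. p i \<omega>))) * euler_value h b s (n - k) k (p k \<omega>))"
      proof -
        have "E \<omega> = exp (- (h * (\<Sum>i<k. p i \<omega>))) * exp (- h * p k \<omega>)"
          by (simp add: E_def exp_add[symmetric] algebra_simps)
        then show ?thesis by (simp add: nk mult.assoc)
      qed
      finally show "(\<integral>\<^sup>+z. ennreal (normal_density 0 (sqrt h) z) * ennreal (E \<omega> * euler_value h b s j (Suc k) (?y + s k * z)) \<partial>lborel)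
          = ennreal (exp (- (h * (\<Sum>i<k. p i \<omega>))) * euler_value h b s (n - k) k (p k \<omega>))" .
    qed
    finally show ?case using Suc by simp
  qed
  from main[of n] show ?thesis by simp
qed

text \<open>Rewrites a sum over coarse cells on a mesh m times finer, each fine cell l inheriting
  the weight of its block \<open>l div m\<close>.\<close>

lemma sum_blocks_telescope:
  fixes Y a :: "nat \<Rightarrow> real"
  assumes "0 < m"
  shows "(\<Sum>l<k * m. a (l div m) * (Y (Suc l) - Y l)) = (\<Sum>i<k. a i * (Y (Suc i * m) - Y (i * m)))"
proof -
  have "(\<Sum>l<k * m. a (l div m) * (Y (Suc l) - Y l))
      = (\<Sum>i<k. \<Sum>l\<in>{i * m..<i * m + m}. a (l div m) * (Y (Suc l) - Y l))"
    by (rule sum.nat_group[symmetric])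
  also have "\<dots> = (\<Sum>i<k. a i * (Y (Suc i * m) - Y (i * m)))"
  proof (rule sum.cong[OF refl])
    fix i
    have "l div m = i" if "l \<in> {i * m..<i * m + m}" for l
      using that assms by (intro div_nat_eqI) (auto simp: mult.commute)
    then have "(\<Sum>l\<in>{i * m..<i * m + m}. a (l div m) * (Y (Suc l) - Y l))
        = (\<Sum>l\<in>{i * m..<i * m + m}. a i * (Y (Suc l) - Y l))"
      by (intro sum.cong) auto
    also have "\<dots> = a i * (Y (Suc i * m) - Y (i * m))"
      by (simp add: sum_Suc_diff' add.commute flip: sum_distrib_left)
    finally show "(\<Sum>l\<in>{i * m..<i * m + m}. a (l div m) * (Y (Suc l) - Y l)) = a i * (Y (Suc i * m) - Y (i * m))" .
  qed
  finally show ?thesis .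
qed

lemma borel_measurable_path_integral:
  fixes Y :: "real \<Rightarrow> 'a \<Rightarrow> real"
  assumes "t \<le> u" and Y: "\<And>r. r \<in> {t..u} \<Longrightarrow> Y r \<in> borel_measurable M"
    and cont: "\<And>\<omega>. \<omega> \<in> space M \<Longrightarrow> continuous_on {t..u} (\<lambda>r. Y r \<omega>)"
  shows "(\<lambda>\<omega>. integral {t..u} (\<lambda>r. Y r \<omega>)) \<in> borel_measurable M"
proof (rule borel_measurable_LIMSEQ_real)
  show "(\<lambda>n. (u - t) / real n * (\<Sum>i<n. Y (t + real i * ((u - t) / real n)) \<omega>))
      \<longlonglongrightarrow> integral {t..u} (\<lambda>r. Y r \<omega>)" if "\<omega> \<in> space M" for \<omega>
    by (rule riemann_sum_tendsto[OF cont[OF that] \<open>t \<le> u\<close>])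
  fix n
  have "t + real i * ((u - t) / real n) \<in> {t..u}" if "i < n" for i
  proof -
    have "real i * ((u - t) / real n) \<le> real n * ((u - t) / real n)"
      using that \<open>t \<le> u\<close> by (intro mult_right_mono) auto
    then show ?thesis using that \<open>t \<le> u\<close> by simp
  qed
  then show "(\<lambda>\<omega>. (u - t) / real n * (\<Sum>i<n. Y (t + real i * ((u - t) / real n)) \<omega>)) \<in> borel_measurable M"
    by (intro borel_measurable_times borel_measurable_const borel_measurable_sum Y) auto
qed

text \<open>Jensen's inequality. It trades the exponential of a time average for an average of
  exponentials, so that moments at single grid times suffice.\<close>

lemma exp_mean_le_mean_exp:
  fixes a :: "nat \<Rightarrow> real"
  assumes "0 < n"
  shows "exp (c * ((\<Sum>i<n. a i) / real n)) \<le> (\<Sum>i<n. exp (c * a i)) / real n"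
proof -
  have "exp (\<Sum>i<n. (1 / real n) *\<^sub>R (c * a i)) \<le> (\<Sum>i<n. (1 / real n) * exp (c * a i))"
    using assms exp_convex by (intro convex_on_sum[where C = UNIV]) auto
  then show ?thesis
    by (simp add: sum_divide_distrib[symmetric] sum_distrib_left[symmetric])
qed

text \<open>Cutting each Euler cell into \<^term>\<open>m\<close> equal parts, the Riemann sum of the Ito integral over
  \<^term>\<open>k * m\<close> cells and the Euler noise are sums over the same mesh, with weights differing by at
  most \<^term>\<open>e\<close>. The exponential moments bound the difference in mean uniformly in \<^term>\<open>m\<close>, and
  Fatou's lemma passes to the limit, which holds only in probability.\<close>

lemma ito_integral_euler_noise_error:
  fixes s :: "real \<Rightarrow> real"
  assumes M: "prob_space M" and filt: "is_filtration M F" and bm: "brownian_motion M F B"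
    and t: "0 \<le> t" and h: "0 < h" and k: "0 < k" and ku: "t + real k * h \<le> u"
    and \<tau>: "real k * h \<le> \<tau>" "0 < \<tau>" and e: "0 < e"
    and H: "\<And>r \<omega>. 0 \<le> r \<Longrightarrow> H r \<omega> = s r"
    and osc: "\<And>r r'. r \<in> {t..u} \<Longrightarrow> r' \<in> {t..u} \<Longrightarrow> \<bar>r - r'\<bar> \<le> h \<Longrightarrow> \<bar>s r - s r'\<bar> \<le> e"
    and W [measurable]: "W \<in> borel_measurable M"
    and ito: "is_ito_integral M H B t (t + real k * h) W"
  shows "(\<integral>\<^sup>+\<omega>. ennreal \<bar>(\<Sum>i<k. s (t + real i * h) * (B (t + real (Suc i) * h) \<omega> - B (t + real i * h) \<omega>)) - W \<omega>\<bar> \<partial>M)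
    \<le> ennreal (e * (2 * sqrt \<tau> * exp 1))"
proof -
  interpret prob_space M by (rule M)
  define S where "S \<omega> = (\<Sum>i<k. s (t + real i * h) * (B (t + real (Suc i) * h) \<omega> - B (t + real i * h) \<omega>))" for \<omega>
  \<comment> \<open>Riemann sums are taken along the multiples of k, where their mesh refines the
    Euler mesh.\<close>
  define R where "R j \<omega> = ito_riemann_sum H B t (t + real k * h) (k * Suc j) \<omega>" for j \<omega>
  define c where "c m l = s (t + real (l div m) * h) - s (t + real l * (h / real m))" for m l
  have Bm: "B r \<in> borel_measurable M" if "0 \<le> r" for r
    using that by (intro filtration_measurable[OF filt, of _ r] brownian_motion_measurable[OF bm filt]) auto
  have grid: "t + real l * (t + real k * h - t) / real (k * m) = t + real l * (h / real m)" for l m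
    using k by simp
  have grid0: "0 \<le> t + real l * (h / real m)" for l m
    using t h by simp
  have R: "R j \<omega> = (\<Sum>l<k * Suc j. s (t + real l * (h / real (Suc j))) *
      (B (t + real (Suc l) * (h / real (Suc j))) \<omega> - B (t + real l * (h / real (Suc j))) \<omega>))" for j \<omega>
    unfolding R_def ito_riemann_sum_def grid by (intro sum.cong refl) (simp only: H[OF grid0])
  have S: "S \<omega> = (\<Sum>l<k * m. s (t + real (l div m) * h) *
      (B (t + real (Suc l) * (h / real m)) \<omega> - B (t + real l * (h / real m)) \<omega>))" if "0 < m" for m \<omega>
  proof -
    have "real (i * m) * (h / real m) = real i * h" for i using that by simp
    then show ?thesis
      using sum_blocks_telescope[OF that, of "\<lambda>i. s (t + real i * h)" "\<lambda>l. B (t + real l * (h / real m)) \<omega>" k]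
      unfolding S_def by (simp only:)
  qed
  have SR: "S \<omega> - R j \<omega> = (\<Sum>l<k * Suc j. c (Suc j) l *
      (B (t + real (Suc l) * (h / real (Suc j))) \<omega> - B (t + real l * (h / real (Suc j))) \<omega>))" for j \<omega>
    unfolding R S[of "Suc j", OF zero_less_Suc] c_def by (simp only: sum_subtractf[symmetric] left_diff_distrib)
  have [measurable]: "S \<in> borel_measurable M"
    unfolding S_def
    by (intro borel_measurable_sum borel_measurable_times borel_measurable_diff borel_measurable_const Bm)
      (use t h in auto)
  have [measurable]: "R j \<in> borel_measurable M" for j
    unfolding R[abs_def]
    by (intro borel_measurable_sum borel_measurable_times borel_measurable_diff borel_measurable_const Bm grid0)
  have "(\<integral>\<^sup>+\<omega>. ennreal \<bar>S \<omega> - W \<omega>\<bar> \<partial>M) \<le> ennreal (e * (2 * sqrt \<tau> * exp 1))"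
  proof (rule nn_integral_le_of_convergence_in_probability[where u = "\<lambda>j \<omega>. S \<omega> - R j \<omega>"])
    fix e' :: real assume "0 < e'"
    then have "(\<lambda>n. measure M {\<omega>\<in>space M. \<bar>ito_riemann_sum H B t (t + real k * h) n \<omega> - W \<omega>\<bar> > e'}) \<longlonglongrightarrow> 0"
      using ito by (simp add: is_ito_integral_def)
    moreover have "strict_mono (\<lambda>j. k * Suc j)" using k by (auto simp: strict_mono_Suc_iff)
    ultimately have "(\<lambda>j. measure M {\<omega>\<in>space M. \<bar>R j \<omega> - W \<omega>\<bar> > e'}) \<longlonglongrightarrow> 0"
      unfolding R_def using LIMSEQ_subseq_LIMSEQ by (fastforce simp: o_def)
    moreover have "\<bar>(S \<omega> - R j \<omega>) - (S \<omega> - W \<omega>)\<bar> = \<bar>R j \<omega> - W \<omega>\<bar>" for j \<omega> by simp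
    ultimately show "(\<lambda>j. measure M {\<omega>\<in>space M. \<bar>(S \<omega> - R j \<omega>) - (S \<omega> - W \<omega>)\<bar> > e'}) \<longlonglongrightarrow> 0"
      by (simp only:)
  next
    fix j
    define m where "m = Suc j"
    have m: "0 < m" by (simp add: m_def)
    show "(\<integral>\<^sup>+\<omega>. ennreal \<bar>S \<omega> - R j \<omega>\<bar> \<partial>M) \<le> ennreal (e * (2 * sqrt \<tau> * exp 1))"
      unfolding SR m_def[symmetric]
    proof (rule nn_integral_abs_brownian_sum[OF M filt bm t _ _ e])
      show "0 < h / real m" using h m by simp
      show "real (k * m) * (h / real m) \<le> \<tau>" "0 < \<tau>" using \<tau> m by simp_all
      fix l assume l: "l < k * m"
      \<comment> \<open>The Euler cell that contains the fine cell l. Both evaluation points lie in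
        it, hence within h of each other.\<close>
      define i where "i = l div m"
      have ml: "real i * real m \<le> real l" "real l \<le> (real i + 1) * real m"
        "(real i + 1) * real m \<le> real k * real m"
      proof -
        have "i * m \<le> l" by (simp add: i_def)
        then show "real i * real m \<le> real l" by (metis of_nat_le_iff of_nat_mult)
        have "l \<le> (i + 1) * m"
          using dividend_less_div_times[OF m, of l] by (simp add: i_def algebra_simps)
        then show "real l \<le> (real i + 1) * real m"
          by (metis of_nat_1 of_nat_add of_nat_le_iff of_nat_mult)
        have "i < k" unfolding i_def using l by (simp add: less_mult_imp_div_less)
        then show "(real i + 1) * real m \<le> real k * real m" by (intro mult_right_mono) auto
      qed
      have q: "real l * (h / real m) = (real l / real m) * h" by simp
      have a: "real i \<le> real l / real m" "real l / real m \<le> real i + 1" "real i + 1 \<le> real k"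
        using ml m by (simp_all add: pos_le_divide_eq pos_divide_le_eq)
      have b: "real i * h \<le> real l * (h / real m)" "real l * (h / real m) \<le> (real i + 1) * h"
          "(real i + 1) * h \<le> real k * h"
        unfolding q using a h by (simp_all only: mult_right_mono less_imp_le)
      have b0: "0 \<le> real i * h" using h by simp
      show "\<bar>c m l\<bar> \<le> e"
        unfolding c_def i_def[symmetric]
      proof (rule osc)
        show "t + real i * h \<in> {t..u}" "t + real l * (h / real m) \<in> {t..u}"
          using b b0 ku h by (auto simp: distrib_right)
        show "\<bar>t + real i * h - (t + real l * (h / real m))\<bar> \<le> h"
          using b by (simp add: distrib_right)
      qed
    qed
  qed measurable
  then show ?thesis by (simp only: S_def)
qed

section \<open>Convergence of the Euler prices\<close>

text \<open>A single starting point x with its own probability space. The function s is the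
  volatility freed from the state, and \<open>t < T\<close> makes the mesh size positive.\<close>

locale additive_noise_sde =
  fixes M :: "'a measure" and F :: "real \<Rightarrow> 'a measure" and B :: "real \<Rightarrow> 'a \<Rightarrow> real"
    and \<beta> \<sigma> :: "real \<Rightarrow> real \<Rightarrow> real" and s :: "real \<Rightarrow> real" and t T D x :: real
    and X :: "real \<Rightarrow> 'a \<Rightarrow> real"
  assumes t: "0 \<le> t" "t < T"
    and sol: "sde_solution M F B \<beta> \<sigma> t T x X"
    and \<beta>_cont: "continuous_on (UNIV \<times> {0..}) (\<lambda>(y, r). \<beta> y r)"
    and \<beta>_growth: "\<And>y r. 0 \<le> r \<Longrightarrow> \<bar>\<beta> y r\<bar> \<le> D * (1 + \<bar>y\<bar>)"
    and \<beta>_convex: "\<And>r. 0 \<le> r \<Longrightarrow> convex_on UNIV (\<lambda>y. \<beta> y r)"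
    and \<sigma>: "\<And>y r. 0 \<le> r \<Longrightarrow> \<sigma> y r = s r"
    and s_cont: "continuous_on {t..T} s"
    and s_bound: "\<And>r. 0 \<le> r \<Longrightarrow> \<bar>s r\<bar> \<le> D"
begin

lemma filt: "is_filtration M F" and bm: "brownian_motion M F B"
  and X_adapted: "\<And>r. r \<in> {t..T} \<Longrightarrow> X r \<in> borel_measurable (F r)"
  and X_start: "\<And>\<omega>. \<omega> \<in> space M \<Longrightarrow> X t \<omega> = x"
  and X_cont: "\<And>\<omega>. \<omega> \<in> space M \<Longrightarrow> continuous_on {t..T} (\<lambda>r. X r \<omega>)"
  and X_ito: "\<And>u. u \<in> {t..T} \<Longrightarrow> is_ito_integral M (\<lambda>r \<omega>. \<sigma> (X r \<omega>) r) B t u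
        (\<lambda>\<omega>. X u \<omega> - x - integral {t..u} (\<lambda>r. \<beta> (X r \<omega>) r))"
  and prob_space_M: "prob_space M"
  using sol unfolding sde_solution_def by blast+

sublocale prob_space M by (rule prob_space_M)

lemma D: "0 \<le> D"
  using s_bound[of 0] by (simp add: order_trans[OF abs_ge_zero])

text \<open>Counting \<open>Suc n\<close> steps avoids a division by zero at n = 0.\<close>

definition h :: "nat \<Rightarrow> real" where "h n = (T - t) / real (Suc n)"
definition b :: "nat \<Rightarrow> nat \<Rightarrow> real \<Rightarrow> real" where "b n k y = \<beta> y (t + real k * h n)"
definition c :: "nat \<Rightarrow> nat \<Rightarrow> real" where "c n k = s (t + real k * h n)"
definition \<xi> :: "nat \<Rightarrow> nat \<Rightarrow> 'a \<Rightarrow> real" where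
  "\<xi> n k \<omega> = c n k * (B (t + real (Suc k) * h n) \<omega> - B (t + real k * h n) \<omega>)"
definition S :: "nat \<Rightarrow> nat \<Rightarrow> 'a \<Rightarrow> real" where "S n k \<omega> = (\<Sum>i<k. \<xi> n i \<omega>)"
definition p :: "nat \<Rightarrow> nat \<Rightarrow> 'a \<Rightarrow> real" where "p n k \<omega> = euler_path (h n) (b n) x (\<lambda>k. \<xi> n k \<omega>) k"
definition A :: "nat \<Rightarrow> 'a \<Rightarrow> real" where "A n \<omega> = h n * (\<Sum>i<Suc n. p n i \<omega>)"
text \<open>The stochastic part of X, read off from the equation; by \<open>X_ito\<close> it is a
  version of the Ito integral.\<close>

definition W :: "real \<Rightarrow> 'a \<Rightarrow> real" where
  "W u \<omega> = X u \<omega> - x - integral {t..u} (\<lambda>r. \<beta> (X r \<omega>) r)"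
text \<open>The distance between Euler noise and exact noise, summed over time: the one error that
  is controlled in mean and not path by path.\<close>

definition \<delta> :: "nat \<Rightarrow> 'a \<Rightarrow> real" where
  "\<delta> n \<omega> = h n * (\<Sum>i<Suc n. \<bar>S n i \<omega> - W (t + real i * h n) \<omega>\<bar>)"

section \<open>Grid points, coefficient bounds and measurability\<close>

lemma h_pos: "0 < h n"
  using t by (simp add: h_def)

lemma Suc_n_h: "real (Suc n) * h n = T - t"
  by (simp add: h_def)

lemma h_tendsto: "h \<longlonglongrightarrow> 0"
  unfolding h_def[abs_def] by (rule LIMSEQ_Suc[OF lim_const_over_n])

lemma grid: "t + real k * h n \<in> {t..T}" if "k \<le> Suc n"
proof -
  have "real k * h n \<le> real (Suc n) * h n" "0 \<le> real k * h n"
    using h_pos[of n] that by (auto intro: mult_right_mono)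
  then show ?thesis
    using Suc_n_h[of n] by auto
qed

lemma grid_nonneg: "0 \<le> t + real k * h n"
  using h_pos[of n] t by simp

lemma b_convex: "convex_on UNIV (b n k)" and b_growth: "\<bar>b n k y\<bar> \<le> D * (1 + \<bar>y\<bar>)"
  and c_bound: "\<bar>c n k\<bar> \<le> D"
  unfolding b_def[abs_def] c_def by (rule \<beta>_convex \<beta>_growth s_bound grid_nonneg)+

lemma b_lipschitz: "\<bar>b n k y - b n k z\<bar> \<le> D * \<bar>y - z\<bar>"
  by (rule convex_linear_growth_lipschitz[OF b_convex b_growth])

lemma B_measurable: "0 \<le> r \<Longrightarrow> B r \<in> borel_measurable M"
  by (rule filtration_measurable[OF filt brownian_motion_measurable[OF bm filt]]) auto

lemma X_measurable: "r \<in> {t..T} \<Longrightarrow> X r \<in> borel_measurable M"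
  using t by (intro filtration_measurable[OF filt X_adapted]) auto

lemma \<beta>_measurable: "0 \<le> r \<Longrightarrow> (\<lambda>y. \<beta> y r) \<in> borel_measurable borel"
  using \<beta>_convex by (intro borel_measurable_continuous_onI convex_on_continuous) auto

lemma drift_cont:
  assumes "\<omega> \<in> space M"
  shows "continuous_on {t..T} (\<lambda>r. \<beta> (X r \<omega>) r)"
proof -
  have "continuous_on {t..T} (\<lambda>r. case (X r \<omega>, r) of (y, r) \<Rightarrow> \<beta> y r)"
    using t by (intro continuous_on_compose2[OF \<beta>_cont] continuous_on_Pair X_cont[OF assms] continuous_on_id) auto
  then show ?thesis by simp
qed

lemma W_measurable:
  assumes u: "u \<in> {t..T}"
  shows "W u \<in> borel_measurable M"
proof -
  have sub: "{t..u} \<subseteq> {t..T}" using u by auto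
  have "(\<lambda>\<omega>. integral {t..u} (\<lambda>r. \<beta> (X r \<omega>) r)) \<in> borel_measurable M"
  proof (rule borel_measurable_path_integral)
    fix r assume "r \<in> {t..u}"
    then have "r \<in> {t..T}" "0 \<le> r" using sub t by auto
    then show "(\<lambda>\<omega>. \<beta> (X r \<omega>) r) \<in> borel_measurable M"
      by (intro measurable_compose[OF X_measurable \<beta>_measurable])
  qed (use u in \<open>auto intro: continuous_on_subset[OF drift_cont]\<close>)
  then show ?thesis
    unfolding W_def[abs_def] by (intro borel_measurable_diff X_measurable[OF u]) auto
qed

lemma \<xi>_measurable: "\<xi> n k \<in> borel_measurable M"
  unfolding \<xi>_def[abs_def]
  by (intro borel_measurable_times borel_measurable_diff borel_measurable_const B_measurable grid_nonneg)

lemma S_measurable [measurable]: "S n k \<in> borel_measurable M"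
  unfolding S_def[abs_def] by (intro borel_measurable_sum \<xi>_measurable)

lemma p_measurable [measurable]: "p n k \<in> borel_measurable M"
  unfolding p_def[abs_def]
proof (rule euler_path_measurable)
  show "b n k \<in> borel_measurable borel" for k
    unfolding b_def[abs_def] by (rule \<beta>_measurable[OF grid_nonneg])
qed (rule \<xi>_measurable)

lemma A_measurable [measurable]: "A n \<in> borel_measurable M"
  unfolding A_def[abs_def] by measurable

lemma \<delta>_term_measurable:
  "i \<le> Suc n \<Longrightarrow> (\<lambda>\<omega>. \<bar>S n i \<omega> - W (t + real i * h n) \<omega>\<bar>) \<in> borel_measurable M"
  by (intro borel_measurable_abs borel_measurable_diff S_measurable W_measurable grid)

lemma \<delta>_measurable: "\<delta> n \<in> borel_measurable M"
  unfolding \<delta>_def[abs_def]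
  by (intro borel_measurable_times borel_measurable_const borel_measurable_sum \<delta>_term_measurable) auto

lemma \<delta>_nonneg: "0 \<le> \<delta> n \<omega>"
  unfolding \<delta>_def using h_pos[of n] by (simp add: sum_nonneg)

lemma \<delta>_le:
  assumes e: "0 < e"
    and osc: "\<And>r r'. r \<in> {t..T} \<Longrightarrow> r' \<in> {t..T} \<Longrightarrow> \<bar>r - r'\<bar> \<le> h n \<Longrightarrow> \<bar>s r - s r'\<bar> \<le> e"
  shows "(\<integral>\<^sup>+\<omega>. ennreal (\<delta> n \<omega>) \<partial>M) \<le> ennreal (e * ((T - t) * (2 * sqrt (T - t) * exp 1)))"
proof -
  define C where "C = e * (2 * sqrt (T - t) * exp 1)"
  have C: "0 \<le> C" using e t by (simp add: C_def)
  have step: "(\<integral>\<^sup>+\<omega>. ennreal \<bar>S n i \<omega> - W (t + real i * h n) \<omega>\<bar> \<partial>M) \<le> ennreal C" if i: "i < Suc n" for i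
  \<comment> \<open>At the starting time both noises are 0; the comparison with the Ito integral is
    for a positive number of cells.\<close>
  proof (cases "i = 0")
    case True
    have "(\<integral>\<^sup>+\<omega>. ennreal \<bar>S n i \<omega> - W (t + real i * h n) \<omega>\<bar> \<partial>M) = (\<integral>\<^sup>+\<omega>. 0 \<partial>M)"
      using True X_start by (intro nn_integral_cong) (simp add: S_def W_def)
    then show ?thesis by simp
  next
    case False
    note g = grid[of i n]
    have "(\<integral>\<^sup>+\<omega>. ennreal \<bar>(\<Sum>k<i. s (t + real k * h n) *
        (B (t + real (Suc k) * h n) \<omega> - B (t + real k * h n) \<omega>)) - W (t + real i * h n) \<omega>\<bar> \<partial>M)
      \<le> ennreal (e * (2 * sqrt (T - t) * exp 1))"
    proof (rule ito_integral_euler_noise_error[OF prob_space_M filt bm t(1) h_pos])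
      show "t + real i * h n \<le> T" "real i * h n \<le> T - t" using g i by auto
      show "is_ito_integral M (\<lambda>r \<omega>. \<sigma> (X r \<omega>) r) B t (t + real i * h n) (W (t + real i * h n))"
        unfolding W_def[abs_def] using g i by (intro X_ito) auto
      show "W (t + real i * h n) \<in> borel_measurable M" using g i by (intro W_measurable) auto
    qed (use False t e \<sigma> osc in auto)
    then show ?thesis by (simp add: S_def \<xi>_def c_def C_def)
  qed
  have "(\<integral>\<^sup>+\<omega>. ennreal (\<delta> n \<omega>) \<partial>M)
      = (\<integral>\<^sup>+\<omega>. ennreal (h n) * (\<Sum>i<Suc n. ennreal \<bar>S n i \<omega> - W (t + real i * h n) \<omega>\<bar>) \<partial>M)"
    unfolding \<delta>_def using h_pos[of n]
    by (intro nn_integral_cong) (simp only: sum_ennreal abs_ge_zero ennreal_mult sum_nonneg less_imp_le)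
  also have "\<dots> = ennreal (h n) * (\<integral>\<^sup>+\<omega>. (\<Sum>i<Suc n. ennreal \<bar>S n i \<omega> - W (t + real i * h n) \<omega>\<bar>) \<partial>M)"
    by (intro nn_integral_cmult borel_measurable_sum measurable_compose[OF \<delta>_term_measurable measurable_ennreal]) auto
  also have "\<dots> = ennreal (h n) * (\<Sum>i<Suc n. (\<integral>\<^sup>+\<omega>. ennreal \<bar>S n i \<omega> - W (t + real i * h n) \<omega>\<bar> \<partial>M))"
    by (subst nn_integral_sum) (auto intro!: \<delta>_term_measurable)
  also have "\<dots> \<le> ennreal (h n) * (\<Sum>i<Suc n. ennreal C)"
    by (intro mult_left_mono sum_mono step) auto
  also have "\<dots> = ennreal (real (Suc n) * h n * C)"
    using h_pos[of n] C by (simp add: sum_constant_scale ennreal_mult mult_ac less_imp_le ennreal_of_nat_eq_real_of_nat del: of_nat_Suc)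
  also have "real (Suc n) * h n * C = e * ((T - t) * (2 * sqrt (T - t) * exp 1))"
    unfolding Suc_n_h by (simp add: C_def)
  finally show ?thesis .
qed

lemma \<delta>_tendsto_0: "(\<lambda>n. \<integral>\<^sup>+\<omega>. ennreal \<bar>\<delta> n \<omega>\<bar> \<partial>M) \<longlonglongrightarrow> 0"
proof (rule tendsto_zero_ennreal)
  fix e :: real assume e: "0 < e"
  define K where "K = (T - t) * (2 * sqrt (T - t) * exp 1)"
  have K: "0 < K" using t by (simp add: K_def)
  from e K have "0 < e / (2 * K)" by simp
  from eventually_oscillation_le[OF s_cont this h_tendsto]
  show "\<forall>\<^sub>F n in sequentially. (\<integral>\<^sup>+\<omega>. ennreal \<bar>\<delta> n \<omega>\<bar> \<partial>M) < ennreal e"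
  proof eventually_elim
    case (elim n)
    have "(\<integral>\<^sup>+\<omega>. ennreal (\<delta> n \<omega>) \<partial>M) \<le> ennreal (e / (2 * K) * K)"
      unfolding K_def by (rule \<delta>_le) (use elim \<open>0 < e / (2 * K)\<close> in \<open>auto simp: K_def\<close>)
    also have "\<dots> < ennreal e" using e K by (intro ennreal_lessI) auto
    finally show ?case using \<delta>_nonneg by simp
  qed
qed

text \<open>On a fixed path, uniform continuity removes the Riemann sum error of X and the
  quadrature error of the drift, the latter amplified by Gronwall. The noise error \<delta> stays in
  the bound, since it is known to be small only in mean.\<close>

lemma eventually_A_error:
  assumes \<omega>: "\<omega> \<in> space M" and e: "0 < e"
  shows "\<forall>\<^sub>F n in sequentially. \<bar>A n \<omega> - integral {t..T} (\<lambda>r. X r \<omega>)\<bar> \<le> e + exp (D * (T - t)) * \<delta> n \<omega>"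
proof -
  define E where "E = exp (D * (T - t))"
  \<comment> \<open>One e1 pays for the Riemann sum of X. The drift error is at most
    \<open>(T - t) * e1\<close> at each grid point; summed over time and amplified by E it accounts
    for the rest of e.\<close>
  define e1 where "e1 = e / (1 + E * (T - t)\<^sup>2)"
  have E: "0 < 1 + E * (T - t)\<^sup>2" unfolding E_def by (intro add_pos_nonneg) auto
  have e1: "0 < e1" "e1 + E * (T - t)\<^sup>2 * e1 = e"
  proof -
    show "0 < e1" unfolding e1_def using e E by (rule divide_pos_pos)
    have "e1 + E * (T - t)\<^sup>2 * e1 = (1 + E * (T - t)\<^sup>2) * e1" by (simp add: algebra_simps)
    also have "\<dots> = e" unfolding e1_def using E by simp
    finally show "e1 + E * (T - t)\<^sup>2 * e1 = e" .
  qed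
  have "(\<lambda>n. h n * (\<Sum>i<Suc n. X (t + real i * h n) \<omega>)) \<longlonglongrightarrow> integral {t..T} (\<lambda>r. X r \<omega>)"
    unfolding h_def using t by (intro LIMSEQ_Suc[OF riemann_sum_tendsto] X_cont[OF \<omega>]) auto
  then have "\<forall>\<^sub>F n in sequentially. dist (h n * (\<Sum>i<Suc n. X (t + real i * h n) \<omega>)) (integral {t..T} (\<lambda>r. X r \<omega>)) < e1"
    using e1(1) by (rule tendstoD)
  with eventually_oscillation_le[OF drift_cont[OF \<omega>] e1(1) h_tendsto]
  show ?thesis
  proof eventually_elim
    case (elim n)
    let ?Y = "\<lambda>i. X (t + real i * h n) \<omega>"
    let ?g = "\<lambda>r. \<beta> (X r \<omega>) r"
    have "h n * (\<Sum>i<Suc n. \<bar>?Y i - euler_path (h n) (b n) x (\<lambda>k. \<xi> n k \<omega>) i\<bar>)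
        \<le> exp (D * (real (Suc n) * h n)) * (real (Suc n) * h n * ((T - t) * e1)
          + h n * (\<Sum>i<Suc n. \<bar>(\<Sum>j<i. \<xi> n j \<omega>) - W (t + real i * h n) \<omega>\<bar>))"
    proof (rule euler_path_error)
      fix k assume k: "k < Suc n"
      have "\<bar>integral {t..t + real k * h n} ?g - h n * (\<Sum>i<k. ?g (t + real i * h n))\<bar> \<le> real k * h n * e1"
      proof (rule riemann_sum_error[OF drift_cont[OF \<omega>]])
        show "0 \<le> h n" using h_pos[of n] by simp
        show "t + real k * h n \<le> T" using grid[of k n] k by simp
      qed (use elim(1) in blast)
      also have "\<dots> \<le> (T - t) * e1"
        using grid[of k n] k e1(1) by (intro mult_right_mono) auto
      also have "integral {t..t + real k * h n} ?g - h n * (\<Sum>i<k. ?g (t + real i * h n))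
          = ?Y k - (x + h n * (\<Sum>i<k. b n i (?Y i)) + W (t + real k * h n) \<omega>)"
        by (simp add: W_def b_def)
      finally show "\<bar>?Y k - (x + h n * (\<Sum>i<k. b n i (?Y i)) + W (t + real k * h n) \<omega>)\<bar> \<le> (T - t) * e1" .
    qed (use h_pos[of n] D b_lipschitz t e1(1) in auto)
    then have err: "h n * (\<Sum>i<Suc n. \<bar>?Y i - p n i \<omega>\<bar>) \<le> E * ((T - t) * ((T - t) * e1) + \<delta> n \<omega>)"
      unfolding Suc_n_h E_def \<delta>_def S_def p_def .
    have "\<bar>h n * (\<Sum>i<Suc n. ?Y i) - A n \<omega>\<bar> = h n * \<bar>\<Sum>i<Suc n. ?Y i - p n i \<omega>\<bar>"
      unfolding A_def using h_pos[of n]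
      by (simp only: right_diff_distrib[symmetric] sum_subtractf[symmetric] abs_mult abs_of_pos)
    also have "\<dots> \<le> h n * (\<Sum>i<Suc n. \<bar>?Y i - p n i \<omega>\<bar>)"
      using h_pos[of n] by (intro mult_left_mono sum_abs) auto
    also note err
    finally have "\<bar>h n * (\<Sum>i<Suc n. ?Y i) - A n \<omega>\<bar> \<le> E * (T - t)\<^sup>2 * e1 + E * \<delta> n \<omega>"
      by (simp add: power2_eq_square algebra_simps)
    then show ?case
      using elim(2) e1(2) unfolding E_def[symmetric] dist_real_def by linarith
  qed
qed

lemma A_tendsto:
  assumes \<omega>: "\<omega> \<in> space M" and q: "strict_mono q" and \<delta>: "(\<lambda>n. \<delta> (q n) \<omega>) \<longlonglongrightarrow> 0"
  shows "(\<lambda>n. A (q n) \<omega>) \<longlonglongrightarrow> integral {t..T} (\<lambda>r. X r \<omega>)"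
proof (rule tendstoI)
  fix e :: real assume e: "0 < e"
  define E where "E = exp (D * (T - t))"
  have "(\<lambda>n. E * \<delta> (q n) \<omega>) \<longlonglongrightarrow> 0" using tendsto_mult_left[OF \<delta>, of E] by simp
  then have "\<forall>\<^sub>F n in sequentially. E * \<delta> (q n) \<omega> < e / 2" using e by (intro order_tendstoD(2)) auto
  moreover have "\<forall>\<^sub>F n in sequentially. \<bar>A (q n) \<omega> - integral {t..T} (\<lambda>r. X r \<omega>)\<bar> \<le> e / 2 + E * \<delta> (q n) \<omega>"
    unfolding E_def using e by (intro eventually_subseq[OF q eventually_A_error[OF \<omega>]]) auto
  ultimately show "\<forall>\<^sub>F n in sequentially. dist (A (q n) \<omega>) (integral {t..T} (\<lambda>r. X r \<omega>)) < e"
    by eventually_elim (simp add: dist_real_def)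
qed

text \<open>The pathwise bound is affine in the time average of the absolute noise. Jensen's
  inequality reduces its exponential to single grid times, where the moment bound is uniform in
  n.\<close>

lemma exp_A_square_bounded:
  obtains K where "0 \<le> K" "\<And>n. (\<integral>\<^sup>+\<omega>. ennreal ((exp (- A n \<omega>))\<^sup>2) \<partial>M) \<le> ennreal K"
proof -
  define a where "a = exp (D * (T - t)) * ((T - t) * (\<bar>x\<bar> + D * (T - t)))"
  \<comment> \<open>The 2 comes from squaring, the exponential from Gronwall, and T - t from writing
    \<open>h n\<close> times a sum as T - t times a mean.\<close>
  define d where "d = 2 * exp (D * (T - t)) * (T - t)"
  define K where "K = 2 * exp (d\<^sup>2 * D\<^sup>2 * (T - t) / 2)"
  have pt: "(exp (- A n \<omega>))\<^sup>2 \<le> exp (2 * a) * ((\<Sum>i<Suc n. exp (d * \<bar>S n i \<omega>\<bar>)) / real (Suc n))" for n \<omega>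
  proof -
    have "- A n \<omega> \<le> h n * (\<Sum>i<Suc n. \<bar>p n i \<omega>\<bar>)"
    proof -
      have "- A n \<omega> = h n * (\<Sum>i<Suc n. - p n i \<omega>)" unfolding A_def sum_negf by (simp only: mult_minus_right)
      also have "\<dots> \<le> h n * (\<Sum>i<Suc n. \<bar>p n i \<omega>\<bar>)"
        using h_pos[of n] by (intro mult_left_mono sum_mono) auto
      finally show ?thesis .
    qed
    also have "\<dots> \<le> exp (D * (real (Suc n) * h n)) *
        (real (Suc n) * h n * (\<bar>x\<bar> + D * (real (Suc n) * h n)) + h n * (\<Sum>i<Suc n. \<bar>\<Sum>j<i. \<xi> n j \<omega>\<bar>))"
      unfolding p_def using h_pos[of n] b_growth by (intro euler_path_bound) auto
    also have "\<dots> = a + exp (D * (T - t)) * (h n * (\<Sum>i<Suc n. \<bar>S n i \<omega>\<bar>))"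
      unfolding Suc_n_h a_def S_def by (simp add: distrib_left)
    also have "h n * (\<Sum>i<Suc n. \<bar>S n i \<omega>\<bar>) = (T - t) * ((\<Sum>i<Suc n. \<bar>S n i \<omega>\<bar>) / real (Suc n))"
      unfolding h_def by simp
    finally have "2 * - A n \<omega> \<le> 2 * a + d * ((\<Sum>i<Suc n. \<bar>S n i \<omega>\<bar>) / real (Suc n))"
      unfolding d_def by linarith
    then have "exp (2 * - A n \<omega>) \<le> exp (2 * a) * exp (d * ((\<Sum>i<Suc n. \<bar>S n i \<omega>\<bar>) / real (Suc n)))"
      by (simp only: exp_add[symmetric] exp_le_cancel_iff)
    also have "\<dots> \<le> exp (2 * a) * ((\<Sum>i<Suc n. exp (d * \<bar>S n i \<omega>\<bar>)) / real (Suc n))"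
      by (intro mult_left_mono exp_mean_le_mean_exp) auto
    finally show ?thesis by (simp only: exp_double[symmetric])
  qed
  have S: "(\<integral>\<^sup>+\<omega>. ennreal (exp (d * \<bar>S n i \<omega>\<bar>)) \<partial>M) \<le> ennreal K" if i: "i < Suc n" for n i
  proof -
    have d: "0 \<le> d" using t by (simp add: d_def)
    have "(\<integral>\<^sup>+\<omega>. ennreal (exp (d * \<bar>S n i \<omega>\<bar>)) \<partial>M) = (\<integral>\<^sup>+\<omega>. ennreal (exp \<bar>d * S n i \<omega>\<bar>) \<partial>M)"
      using d by (simp add: abs_mult)
    also have "\<dots> \<le> ennreal (2 * exp (d\<^sup>2 * D\<^sup>2 * (real i * h n) / 2))"
      unfolding S_def \<xi>_def
      by (rule nn_integral_exp_abs_brownian_sum[OF prob_space_M filt bm t(1) h_pos c_bound])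
    also have "\<dots> \<le> ennreal K"
      unfolding K_def using grid[of i n] i by (intro ennreal_leI) (auto intro!: mult_left_mono divide_right_mono)
    finally show ?thesis .
  qed
  have K: "0 \<le> K" by (simp add: K_def)
  show ?thesis
  proof (rule that)
    show "0 \<le> exp (2 * a) * K" using K by simp
    fix n
    define w where "w = exp (2 * a) / real (Suc n)"
    have w: "0 \<le> w" "real (Suc n) * w = exp (2 * a)" by (simp_all add: w_def)
    have "(\<integral>\<^sup>+\<omega>. ennreal ((exp (- A n \<omega>))\<^sup>2) \<partial>M)
        \<le> (\<integral>\<^sup>+\<omega>. ennreal w * (\<Sum>i<Suc n. ennreal (exp (d * \<bar>S n i \<omega>\<bar>))) \<partial>M)"
    proof (rule nn_integral_mono)
      fix \<omega>
      have "ennreal w * (\<Sum>i<Suc n. ennreal (exp (d * \<bar>S n i \<omega>\<bar>)))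
          = ennreal (exp (2 * a) * ((\<Sum>i<Suc n. exp (d * \<bar>S n i \<omega>\<bar>)) / real (Suc n)))"
        using w(1) by (simp only: w_def sum_ennreal exp_ge_zero ennreal_mult'[symmetric]
            times_divide_eq_left times_divide_eq_right)
      then show "ennreal ((exp (- A n \<omega>))\<^sup>2) \<le> ennreal w * (\<Sum>i<Suc n. ennreal (exp (d * \<bar>S n i \<omega>\<bar>)))"
        using ennreal_leI[OF pt[of n \<omega>]] by (simp only:)
    qed
    also have "\<dots> = ennreal w * (\<integral>\<^sup>+\<omega>. (\<Sum>i<Suc n. ennreal (exp (d * \<bar>S n i \<omega>\<bar>))) \<partial>M)"
      by (rule nn_integral_cmult) measurable
    also have "\<dots> = ennreal w * (\<Sum>i<Suc n. (\<integral>\<^sup>+\<omega>. ennreal (exp (d * \<bar>S n i \<omega>\<bar>)) \<partial>M))"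
      by (subst nn_integral_sum) auto
    also have "\<dots> \<le> ennreal w * (\<Sum>i<Suc n. ennreal K)"
      by (intro mult_left_mono sum_mono S) auto
    also have "\<dots> = ennreal (real (Suc n) * w * K)"
      using w(1) K by (simp add: sum_constant_scale ennreal_mult mult_ac ennreal_of_nat_eq_real_of_nat del: of_nat_Suc)
    finally show "(\<integral>\<^sup>+\<omega>. ennreal ((exp (- A n \<omega>))\<^sup>2) \<partial>M) \<le> ennreal (exp (2 * a) * K)"
      unfolding w(2) .
  qed
qed

text \<open>Starts from an arbitrary subsequence, as the subsequence criterion demands.
  Integrability is recorded for the proof that the price is positive.\<close>

lemma bond_price_subseq:
  assumes r: "strict_mono (r :: nat \<Rightarrow> nat)"
  shows "\<exists>r'. strict_mono r' \<and> integrable M (\<lambda>\<omega>. exp (- integral {t..T} (\<lambda>r. X r \<omega>)))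
    \<and> (\<lambda>n. \<integral>\<omega>. exp (- A (r (r' n)) \<omega>) \<partial>M) \<longlonglongrightarrow> bond_price M X t T"
proof -
  obtain r' :: "nat \<Rightarrow> nat" where r': "strict_mono r'" and ae: "AE \<omega> in M. (\<lambda>n. \<delta> (r (r' n)) \<omega>) \<longlonglongrightarrow> 0"
    using AE_subseq_of_nn_integral_tendsto_0[of "\<lambda>n. \<delta> (r n)", OF \<delta>_measurable
        LIMSEQ_subseq_LIMSEQ[OF \<delta>_tendsto_0 r, unfolded o_def]] by blast
  have mono: "strict_mono (\<lambda>n. r (r' n))" using strict_mono_o[OF r r'] by (simp add: o_def)
  have lim: "AE \<omega> in M. (\<lambda>n. exp (- A (r (r' n)) \<omega>)) \<longlonglongrightarrow> exp (- integral {t..T} (\<lambda>r. X r \<omega>))"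
    using ae by (rule AE_mp) (auto intro!: AE_I2 tendsto_exp tendsto_minus A_tendsto[OF _ mono])
  have meas: "(\<lambda>\<omega>. integral {t..T} (\<lambda>r. X r \<omega>)) \<in> borel_measurable M"
    using t by (intro borel_measurable_path_integral X_measurable X_cont) auto
  obtain K where K: "0 \<le> K" "\<And>n. (\<integral>\<^sup>+\<omega>. ennreal ((exp (- A n \<omega>))\<^sup>2) \<partial>M) \<le> ennreal K"
    using exp_A_square_bounded by blast
  have m1: "(\<lambda>\<omega>. exp (- A n \<omega>)) \<in> borel_measurable M" for n by measurable
  have m2: "(\<lambda>\<omega>. exp (- integral {t..T} (\<lambda>r. X r \<omega>))) \<in> borel_measurable M"
    using meas by measurable
  note res = integral_tendsto_of_square_bounded[of "\<lambda>n \<omega>. exp (- A (r (r' n)) \<omega>)", OF m1 m2 _ _ lim K(2) K(1)]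
  show ?thesis
    unfolding bond_price_def using r' res(1) res(3) by (intro exI[of _ r']) auto
qed

text \<open>Integrability matters here: the Bochner integral of a non-integrable function is 0 by
  default.\<close>

lemma bond_price_pos: "0 < bond_price M X t T"
proof -
  have "integrable M (\<lambda>\<omega>. exp (- integral {t..T} (\<lambda>r. X r \<omega>)))"
    using bond_price_subseq[of "\<lambda>n. n"] by (auto simp: strict_mono_def)
  then show ?thesis
    unfolding bond_price_def by (rule expectation_greater) simp
qed

text \<open>The left side involves only the coefficients, the times and x, whereas the limit is an
  expectation on the space of the solution. The two are linked once \<open>h n * D < 1\<close>,
  where the recursion represents the expected Euler discount factor.\<close>

lemma euler_value_tendsto_bond_price:
  "(\<lambda>n. euler_value (h n) (b n) (c n) (Suc n) 0 x) \<longlonglongrightarrow> bond_price M X t T"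
proof (rule tendsto_of_subsubsequences)
  have "(\<lambda>n. h n * D) \<longlonglongrightarrow> 0" using tendsto_mult_right[OF h_tendsto, of D] by simp
  then have "\<forall>\<^sub>F n in sequentially. h n * D < 1" by (rule order_tendstoD) simp
  then have eq: "\<forall>\<^sub>F n in sequentially. (\<integral>\<omega>. exp (- A n \<omega>) \<partial>M) = euler_value (h n) (b n) (c n) (Suc n) 0 x"
  proof eventually_elim
    case (elim n)
    have "(\<integral>\<^sup>+\<omega>. ennreal (exp (- (h n * (\<Sum>i<Suc n. p n i \<omega>)))) \<partial>M)
        = ennreal (euler_value (h n) (b n) (c n) (Suc n) 0 x)"
      by (rule nn_integral_euler_path[OF prob_space_M filt bm t(1) h_pos _ b_convex b_growth])
        (use elim in \<open>auto simp: p_def \<xi>_def\<close>)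
    moreover have "antimono_log_concave (euler_value (h n) (b n) (c n) (Suc n) 0)"
      using elim by (intro euler_value_antimono_log_concave[OF h_pos _ b_convex b_growth]) simp
    then have "0 < euler_value (h n) (b n) (c n) (Suc n) 0 x"
      unfolding antimono_log_concave_def by blast
    moreover have "(\<integral>\<omega>. exp (- A n \<omega>) \<partial>M) = enn2real (\<integral>\<^sup>+\<omega>. ennreal (exp (- A n \<omega>)) \<partial>M)"
      by (rule integral_eq_nn_integral) auto
    ultimately show ?case
      unfolding A_def by (simp only: enn2real_ennreal less_imp_le)
  qed
  fix r :: "nat \<Rightarrow> nat" assume r: "strict_mono r"
  then obtain r' where r': "strict_mono r'"
    and lim: "(\<lambda>n. \<integral>\<omega>. exp (- A (r (r' n)) \<omega>) \<partial>M) \<longlonglongrightarrow> bond_price M X t T"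
    using bond_price_subseq by blast
  have "strict_mono (\<lambda>n. r (r' n))" using strict_mono_o[OF r r'] by (simp add: o_def)
  from eventually_subseq[OF this eq] lim
  have "(\<lambda>n. euler_value (h (r (r' n))) (b (r (r' n))) (c (r (r' n))) (Suc (r (r' n))) 0 x) \<longlonglongrightarrow> bond_price M X t T"
    by (rule Lim_transform_eventually[rotated])
  then show "\<exists>r'. strict_mono r' \<and>
      (\<lambda>n. euler_value (h (r (r' n))) (b (r (r' n))) (c (r (r' n))) (Suc (r (r' n))) 0 x) \<longlonglongrightarrow> bond_price M X t T"
    using r' by blast
qed

end

section \<open>Log-concavity of the bond price\<close>

text \<open>A change of sign would force a zero in between, hence g = 0, and then f vanishes
  everywhere.\<close>

lemma continuous_constant_square_const:
  fixes f :: "real \<Rightarrow> real"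
  assumes cont: "continuous_on UNIV f" and sq: "\<And>y. (f y)\<^sup>2 = g"
  shows "f y = f 0"
proof (rule ccontr)
  assume ne: "f y \<noteq> f 0"
  have "(f y)\<^sup>2 = (f 0)\<^sup>2" by (simp add: sq)
  with ne have opp: "f y = - f 0" by (auto simp: power2_eq_iff)
  have conn: "connected (range f)" using cont by (rule connected_continuous_image) simp
  have "0 \<in> range f"
  proof (cases "f 0 \<le> 0")
    case True
    then show ?thesis using opp by (intro connectedD_interval[OF conn rangeI[of f 0] rangeI[of f y]]) auto
  next
    case False
    then show ?thesis using opp by (intro connectedD_interval[OF conn rangeI[of f y] rangeI[of f 0]]) auto
  qed
  then obtain z where "f z = 0" by auto
  then have "g = 0" using sq[of z] by simp
  then have "f y = 0" "f 0 = 0" using sq[of y] sq[of 0] by simp_all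
  then show False using ne by simp
qed

theorem theorem9p1:
  fixes T :: real and \<beta> \<sigma> :: "real \<Rightarrow> real \<Rightarrow> real" and D :: real
  assumes T_pos: "T > 0"
    and beta_cont: "continuous_on (UNIV \<times> {0..}) (\<lambda>(x, t). \<beta> x t)"
    and sigma_cont: "continuous_on (UNIV \<times> {0..}) (\<lambda>(x, t). \<sigma> x t)"
    and beta_loc_lip: "\<forall>R>0. \<exists>L. \<forall>x y t. \<bar>x\<bar> \<le> R \<longrightarrow> \<bar>y\<bar> \<le> R \<longrightarrow> 0 \<le> t \<longrightarrow> t \<le> R \<longrightarrow>
                          \<bar>\<beta> x t - \<beta> y t\<bar> \<le> L * \<bar>x - y\<bar>"
    and sigma_loc_hoelder: "\<forall>R>0. \<exists>L. \<forall>x y t. \<bar>x\<bar> \<le> R \<longrightarrow> \<bar>y\<bar> \<le> R \<longrightarrow> 0 \<le> t \<longrightarrow> t \<le> R \<longrightarrow>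
                          \<bar>\<sigma> x t - \<sigma> y t\<bar> \<le> L * sqrt \<bar>x - y\<bar>"
    and sigma_growth: "\<forall>x. \<forall>t\<ge>0. \<bar>\<sigma> x t\<bar> \<le> D * (1 + max x 0)"
    and beta_growth: "\<forall>x. \<forall>t\<ge>0. \<bar>\<beta> x t\<bar> \<le> D * (1 + \<bar>x\<bar>)"
    and alpha_indep: "\<exists>\<gamma>::real \<Rightarrow> real. \<forall>x. \<forall>t\<ge>0. (\<sigma> x t)\<^sup>2 / 2 = \<gamma> t"
    and beta_convex: "\<forall>t\<ge>0. convex_on UNIV (\<lambda>x. \<beta> x t)"
  shows "\<forall>t\<in>{0..T}. \<forall>(M :: real \<Rightarrow> 'a measure) F B X.
           (\<forall>x. sde_solution (M x) (F x) (B x) \<beta> \<sigma> t T x (X x)) \<longrightarrow>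
           concave_on UNIV (\<lambda>x. ln (bond_price (M x) (X x) t T))"
proof (intro ballI allI impI)
  fix t and M :: "real \<Rightarrow> 'a measure" and F B X
  assume tT: "t \<in> {0..T}" and sol: "\<forall>x. sde_solution (M x) (F x) (B x) \<beta> \<sigma> t T x (X x)"
  have \<sigma>_cont: "continuous_on UNIV (\<lambda>y. \<sigma> y r)" if "0 \<le> r" for r
  proof -
    have "continuous_on UNIV (\<lambda>y. case (y, r) of (y, r) \<Rightarrow> \<sigma> y r)"
      using that by (intro continuous_on_compose2[OF sigma_cont] continuous_on_Pair continuous_on_id
          continuous_on_const) auto
    then show ?thesis by simp
  qed
  have \<sigma>: "\<sigma> y r = \<sigma> 0 r" if "0 \<le> r" for y r
  proof -
    obtain \<gamma> :: "real \<Rightarrow> real" where \<gamma>: "\<forall>y. \<forall>r\<ge>0. (\<sigma> y r)\<^sup>2 / 2 = \<gamma> r"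
      using alpha_indep by blast
    have "(\<sigma> y r)\<^sup>2 = 2 * \<gamma> r" for y using \<gamma>[rule_format, OF that, of y] by simp
    then show ?thesis by (rule continuous_constant_square_const[OF \<sigma>_cont[OF that]])
  qed
  have s_cont: "continuous_on {t..T} (\<lambda>r. \<sigma> 0 r)"
  proof -
    have "continuous_on {t..T} (\<lambda>r. case (0, r) of (y, r) \<Rightarrow> \<sigma> y r)"
      using tT by (intro continuous_on_compose2[OF sigma_cont] continuous_on_Pair continuous_on_id
          continuous_on_const) auto
    then show ?thesis by simp
  qed
  have s_bound: "\<bar>\<sigma> 0 r\<bar> \<le> D" if "0 \<le> r" for r
    using sigma_growth[rule_format, OF that, of 0] by simp
  show "concave_on UNIV (\<lambda>x. ln (bond_price (M x) (X x) t T))"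
  proof (cases "t = T")
    \<comment> \<open>The integral over a single point is 0, so the price is constantly 1.\<close>
    case True
    have "bond_price (M x) (X x) t T = 1" for x
    proof -
      interpret prob_space "M x" using sol by (simp add: sde_solution_def)
      show ?thesis using True by (simp add: bond_price_def prob_space)
    qed
    then show ?thesis by (simp add: concave_on_const)
  next
    case False
    have sde: "additive_noise_sde (M x) (F x) (B x) \<beta> \<sigma> (\<sigma> 0) t T D x (X x)" for x
    proof
      show "\<bar>\<beta> y r\<bar> \<le> D * (1 + \<bar>y\<bar>)" if "0 \<le> r" for y r
        using beta_growth that by blast
      show "convex_on UNIV (\<lambda>y. \<beta> y r)" if "0 \<le> r" for r
        using beta_convex that by blast
    qed (use tT False sol beta_cont s_cont s_bound in \<open>auto intro: \<sigma>\<close>)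
    \<comment> \<open>Restated outside the locale, whose instance changes with x. Here h and v are
      the same for all x, and concavity in x can be asked of v as one function.\<close>
    define h where "h n = (T - t) / real (Suc n)" for n
    define v where "v n = euler_value (h n) (\<lambda>k y. \<beta> y (t + real k * h n))
      (\<lambda>k. \<sigma> 0 (t + real k * h n)) (Suc n) 0" for n
    have h_eq: "additive_noise_sde.h t T = h"
      by (rule ext) (simp only: additive_noise_sde.h_def[OF sde] h_def)
    have lim: "(\<lambda>n. v n x) \<longlonglongrightarrow> bond_price (M x) (X x) t T" for x
      using additive_noise_sde.euler_value_tendsto_bond_price[OF sde]
      unfolding additive_noise_sde.b_def[OF sde, abs_def] additive_noise_sde.c_def[OF sde, abs_def] h_eq v_def .
    have pos: "0 < bond_price (M x) (X x) t T" for x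
      by (rule additive_noise_sde.bond_price_pos[OF sde])
    have "h \<longlonglongrightarrow> 0" unfolding h_def[abs_def] by (rule LIMSEQ_Suc[OF lim_const_over_n])
    then have "(\<lambda>n. h n * D) \<longlonglongrightarrow> 0" using tendsto_mult_right[of h 0 sequentially D] by simp
    then have "\<forall>\<^sub>F n in sequentially. h n * D < 1" by (rule order_tendstoD) simp
    then have conc: "\<forall>\<^sub>F n in sequentially. concave_on UNIV (\<lambda>x. ln (v n x))"
    proof eventually_elim
      case (elim n)
      have "0 < h n" using tT False by (simp add: h_def)
      have "antimono_log_concave (v n)"
        unfolding v_def
      proof (rule euler_value_antimono_log_concave)
        fix k
        have "0 \<le> t + real k * h n" using tT \<open>0 < h n\<close> by simp
        then show "convex_on UNIV (\<lambda>y. \<beta> y (t + real k * h n))"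
          "\<bar>\<beta> y (t + real k * h n)\<bar> \<le> D * (1 + \<bar>y\<bar>)" for y
          using beta_convex beta_growth by blast+
      qed (use elim \<open>0 < h n\<close> in auto)
      then show ?case by (simp add: antimono_log_concave_def)
    qed
    \<comment> \<open>The limit is positive, so ln is continuous there.\<close>
    have lim_ln: "(\<lambda>n. ln (v n x)) \<longlonglongrightarrow> ln (bond_price (M x) (X x) t T)" for x
      using lim pos[of x] by (intro tendsto_ln) auto
    show ?thesis
    proof
      fix a y z :: real assume a: "0 < a" "a < 1"
      let ?u = "\<lambda>x. ln (bond_price (M x) (X x) t T)"
      show "(1 - a) * ?u y + a * ?u z \<le> ?u ((1 - a) *\<^sub>R y + a *\<^sub>R z)"
      proof (rule tendsto_le[OF sequentially_bot lim_ln])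
        show "(\<lambda>n. (1 - a) * ln (v n y) + a * ln (v n z)) \<longlonglongrightarrow> (1 - a) * ?u y + a * ?u z"
          by (intro tendsto_intros lim_ln)
        show "\<forall>\<^sub>F n in sequentially. (1 - a) * ln (v n y) + a * ln (v n z) \<le> ln (v n ((1 - a) *\<^sub>R y + a *\<^sub>R z))"
          using conc by eventually_elim (use a in \<open>auto dest: concave_onD[of _ _ a y z]\<close>)
      qed
    qed simp
  qed
qed

end
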